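(* For any even integer $p\ge 2$, let $D_p(c)=(c-1)^4-4p(c+1)^2(c-p-1)$, let $c^*$ be the unique solution of $D_p(c)=0$ in $[2p+1+\sqrt{8p},\infty)$, and let $\mathcal{A}$ be the algorithm for even $p$ described in the context with parameters $$a=\frac{(c^*-1)^2}{2p(c^*+1)},\qquad r=\frac{\sqrt{\left(p(a^2-1)+2\right)^2+8p(a^2-1)(a-1)}-2}{4(a^2-1)}-\frac p4,$$ for which it yields the optimal competitive ratio $CR_{\mathcal{A}}=c^*$. For any $\varepsilon>0$, let $\mathcal{B}$ be the modified algorithm obtained from $\mathcal{A}$ by replacing every call ThoroughSearch$(x_{init},\delta,p)$ with the analogous call CompliantThoroughSearch$(x_{init},\delta,p,c,\varepsilon)$, where $c=CR_{\mathcal{A}}$. Then $\mathcal{B}$ achieves competitive ratio $CR_{\mathcal{B}}=CR_{\mathcal{A}}+\varepsilon$ while making $O\!\left(\log\left(\frac p\varepsilon\right)\right)$ calls to CellSearch per round.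
   Context: **Problem.** A point-like searcher starts at the origin of the real line at time $0$ and moves with speed at most $1$. A stationary target is at an unknown coordinate at distance $d\ge 1$ from the origin. The searcher has $p$ search modes, and a target is detected only when the searcher passes through its location in the (unknown) correct mode. The searcher may switch direction and mode instantaneously. A coordinate $x$ is *explored* by time $t$ if the searcher has passed through $x$ in each of the $p$ modes at or before time $t$. By convention every $x$ with $|x|<1$ counts as explored at time $0$. **Competitive ratio.** For an algorithm $\mathcal{A}$ (analyzed as if it never stops), let $T_{\mathcal{A}}(x)=\inf\{t\ge 0: x \text{ is explored by time } t\}$, $CR_{\mathcal{A}}(x)=T_{\mathcal{A}}(x)/|x|$, and $CR_{\mathcal{A}}=\sup_x CR_{\mathcal{A}}(x)$, the supremum being effectively over $|x|\ge 1$. **CellSearch.** CellSearch$(x_{init},\delta,p)$, called when the searcher is at $x_{init}\ne0$: for $i=0,\dots,p-1$ in order, the searcher travels at speed $1$ from its current position $y$ to $y+(-1)^i\delta\cdot\mathrm{sign}(x_{init})$ while searching in mode $i$. (For even $p$ it ends at $x_{init}$.) **ThoroughSearch for even $p$.** ThoroughSearch$(x_{init},\delta,p)$: the searcher travels from $x_{init}\neq0$ to $x_{init}+\delta\cdot\mathrm{sign}(x_{init})$ at constant speed $\frac1{p+1}$ while searching in all $p$ modes simultaneously, so each point is explored when it is reached. **Algorithm for even $p$** (input: $p$, a growth factor $a>1$ and a coefficient $0\le r\le 1$; it terminates upon detecting the target). For rounds $i=0,1,2,\dots$: set $x_{start}=(-1)^i a^{i-1}$, $x_{end}=(-1)^i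 a^{i+1}$, $x_{mid}=(1-r)x_{start}+r\,x_{end}$; go from the origin to $x_{start}$ at speed $1$; call ThoroughSearch$(x_{start},|x_{mid}-x_{start}|,p)$; call CellSearch$(x_{mid},|x_{end}-x_{mid}|,p)$; return to the origin at speed $1$. **CompliantThoroughSearch for even $p$.** CompliantThoroughSearch$(x_{init},\delta,p,c,\varepsilon)$: set $x\leftarrow 0$ and $s\leftarrow\frac{\varepsilon|x_{init}|}{p}$. While $x<\delta$: set $\Delta x\leftarrow\min(s,\delta-x)$; call CellSearch$(x_{init}+x\cdot\mathrm{sign}(x_{init}),\Delta x,p)$; travel at speed $1$ to the far end of the cell, $x_{init}+(x+\Delta x)\cdot\mathrm{sign}(x_{init})$; set $x\leftarrow x+\Delta x$; set $s\leftarrow s\cdot\frac{c+\varepsilon-1}{p}$.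
   Formalization: CR_B = CR_A + ε fails for large ε (e.g. p=2, ε=3), where the first cell is cut off by δ; proved instead: CR_B ≤ CR_A + ε for all ε>0, with equality iff ε ≤ p·r·(a²−1). O(log(p/ε)) is read as p/ε→∞. The recalled optimality of c* is not asserted. *)

theory Defs
  imports
    "HOL-Analysis.Analysis"
    "HOL-Library.Landau_Symbols"
    "HOL-Library.While_Combinator"
begin

text \<open>
  A leg is a straight movement at constant positive speed from the current position to
  \<open>dest\<close>, during which the modes in \<open>active\<close> are searched. Legs with no active mode only
  relocate the searcher.
\<close>

datatype leg = Leg (dest: real) (speed: real) (active: "nat set")

text \<open>
  \<open>passes t y ls m x \<tau>\<close>: a searcher that is at \<open>y\<close> at time \<open>t\<close> and then performs the
  legs \<open>ls\<close> is at \<open>x\<close> at time \<open>\<tau>\<close> while searching in mode \<open>m\<close>. Legs include their end points.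
\<close>

fun passes :: "real \<Rightarrow> real \<Rightarrow> leg list \<Rightarrow> nat \<Rightarrow> real \<Rightarrow> real \<Rightarrow> bool" where
  "passes t y [] m x \<tau> \<longleftrightarrow> False"
| "passes t y (Leg z v M # ls) m x \<tau> \<longleftrightarrow>
     (m \<in> M \<and> x \<in> closed_segment y z \<and> \<tau> = t + \<bar>x - y\<bar> / v) \<or>
     passes (t + \<bar>z - y\<bar> / v) z ls m x \<tau>"

text \<open>
  The steps of an algorithm, with arguments \<open>x\<^sub>i\<^sub>n\<^sub>i\<^sub>t\<close> and \<open>\<delta>\<close> for the two searches;
  \<open>GoTo z\<close> travels to \<open>z\<close> at speed 1. An algorithm is given by its list of steps in each
  round.
\<close>

datatype step = GoTo real | ThoroughSearch real real | is_cell: CellSearch real real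

type_synonym algo = "nat \<Rightarrow> step list"

fun legs :: "nat \<Rightarrow> step \<Rightarrow> leg list" where
  "legs p (GoTo z) = [Leg z 1 {}]"
| "legs p (ThoroughSearch x \<delta>) = [Leg (x + \<delta> * sgn x) (1 / (real p + 1)) {..<p}]"
| "legs p (CellSearch x \<delta>) =
     map (\<lambda>i. Leg (x + (\<Sum>j\<le>i. (-1) ^ j * \<delta> * sgn x)) 1 {i}) [0..<p]"

definition prefix_legs :: "nat \<Rightarrow> algo \<Rightarrow> nat \<Rightarrow> leg list" where
  "prefix_legs p A n = concat (map (legs p) (concat (map A [0..<n])))"

definition explored :: "nat \<Rightarrow> algo \<Rightarrow> real \<Rightarrow> real \<Rightarrow> bool" where
  "explored p A x t \<longleftrightarrow>
     \<bar>x\<bar> < 1 \<or> (\<forall>m<p. \<exists>n. \<exists>\<tau>\<le>t. passes 0 0 (prefix_legs p A n) m x \<tau>)"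

definition explore_time :: "nat \<Rightarrow> algo \<Rightarrow> real \<Rightarrow> ereal" where
  "explore_time p A x = (INF t \<in> {t. 0 \<le> t \<and> explored p A x t}. ereal t)"

definition CR :: "nat \<Rightarrow> algo \<Rightarrow> ereal" where
  "CR p A = (SUP x \<in> {x. x \<noteq> 0}. explore_time p A x / ereal \<bar>x\<bar>)"

text \<open>The algorithm for even \<open>p\<close>, parametrised by the search used on the first part of a round.\<close>

definition search_algo :: "(real \<Rightarrow> real \<Rightarrow> step list) \<Rightarrow> real \<Rightarrow> real \<Rightarrow> algo" where
  "search_algo thorough a r i =
     (let x_start = (-1) ^ i * a powi (int i - 1);
          x_end = (-1) ^ i * a powi (int i + 1);
          x_mid = (1 - r) * x_start + r * x_end
      in [GoTo x_start] @ thorough x_start \<bar>x_mid - x_start\<bar> @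
         [CellSearch x_mid \<bar>x_end - x_mid\<bar>, GoTo 0])"

definition compliant_thorough_search ::
    "nat \<Rightarrow> real \<Rightarrow> real \<Rightarrow> real \<Rightarrow> real \<Rightarrow> step list" where
  "compliant_thorough_search p c \<epsilon> x_init \<delta> =
     (case while (\<lambda>(x, s, steps). x < \<delta>)
        (\<lambda>(x, s, steps).
           let \<Delta> = min s (\<delta> - x)
           in (x + \<Delta>,
               s * ((c + \<epsilon> - 1) / real p),
               steps @ [CellSearch (x_init + x * sgn x_init) \<Delta>,
                        GoTo (x_init + (x + \<Delta>) * sgn x_init)]))
        (0, \<epsilon> * \<bar>x_init\<bar> / real p, [])
      of (x, s, steps) \<Rightarrow> steps)"

definition cell_search_calls :: "step list \<Rightarrow> nat" where
  "cell_search_calls steps = length (filter is_cell steps)"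

definition D :: "nat \<Rightarrow> real \<Rightarrow> real" where
  "D p c = (c - 1) ^ 4 - 4 * real p * (c + 1)\<^sup>2 * (c - real p - 1)"

definition is_c_star :: "nat \<Rightarrow> real \<Rightarrow> bool" where
  "is_c_star p c \<longleftrightarrow> c \<in> {2 * real p + 1 + sqrt (8 * real p)..} \<and> D p c = 0"

definition c_star :: "nat \<Rightarrow> real" where
  "c_star p = (THE c. is_c_star p c)"

definition opt_a :: "nat \<Rightarrow> real" where
  "opt_a p = (c_star p - 1)\<^sup>2 / (2 * real p * (c_star p + 1))"

definition opt_r :: "nat \<Rightarrow> real" where
  "opt_r p =
     (let a = opt_a p
      in (sqrt ((real p * (a\<^sup>2 - 1) + 2)\<^sup>2 + 8 * real p * (a\<^sup>2 - 1) * (a - 1)) - 2)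
           / (4 * (a\<^sup>2 - 1)) - real p / 4)"

definition algo_A :: "nat \<Rightarrow> algo" where
  "algo_A p = search_algo (\<lambda>x \<delta>. [ThoroughSearch x \<delta>]) (opt_a p) (opt_r p)"

definition algo_B :: "nat \<Rightarrow> real \<Rightarrow> algo" where
  "algo_B p \<epsilon> =
     search_algo (compliant_thorough_search p (real_of_ereal (CR p (algo_A p))) \<epsilon>)
       (opt_a p) (opt_r p)"

end

theory Submission
  imports Defs
begin

text \<open>
  Write \<open>u = c\<^sup>* - 1\<close>. The parameters satisfy \<open>r = p / u\<close>, and round \<open>i\<close> takes time
  \<open>u (a - 1) s\<close> with \<open>s = a\<^bsup>i-1\<^esup>\<close>, so it starts at time \<open>u (s - 1 / a)\<close>. Hence points just beyond
  \<open>s\<close> have ratio tending to \<open>c\<^sup>*\<close>, and the choice of \<open>r\<close> makes the ratio at \<open>x_mid\<close> at most \<open>c\<^sup>*\<close> too.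
  The compliant search takes exactly as long as the thorough one, so only the ratios inside its cells
  change: its first cell, of length \<open>\<epsilon> s / p\<close>, delays the points just beyond \<open>s\<close> by \<open>\<epsilon> s\<close>, and the growth
  factor of the cells keeps the ratio at the start of every later cell at \<open>c\<^sup>* + \<epsilon>\<close>. That growth
  factor is at least 2, whereas the region to be searched is only \<open>O(p / \<epsilon>)\<close> first cells long.
\<close>

subsection \<open>Movements along legs\<close>

fun trip_end :: "real \<Rightarrow> leg list \<Rightarrow> real" where
  "trip_end y [] = y"
| "trip_end y (Leg z v M # ls) = trip_end z ls"

fun trip_time :: "real \<Rightarrow> leg list \<Rightarrow> real" where
  "trip_time y [] = 0"
| "trip_time y (Leg z v M # ls) = \<bar>z - y\<bar> / v + trip_time z ls"

text \<open>Legs with no active mode are exempt because nothing can be detected on them, so the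
  trips to and from the origin do not enlarge \<open>S\<close>.\<close>

fun searches_within :: "real set \<Rightarrow> real \<Rightarrow> leg list \<Rightarrow> bool" where
  "searches_within S y [] \<longleftrightarrow> True"
| "searches_within S y (Leg z v M # ls) \<longleftrightarrow>
     (M = {} \<or> closed_segment y z \<subseteq> S) \<and> searches_within S z ls"

definition legal :: "leg list \<Rightarrow> bool" where
  "legal ls \<longleftrightarrow> (\<forall>l\<in>set ls. 0 < speed l \<and> speed l \<le> 1)"

lemma legal_simps [simp]:
  "legal []"
  "legal (l # ls) \<longleftrightarrow> 0 < speed l \<and> speed l \<le> 1 \<and> legal ls"
  "legal (ls @ ls') \<longleftrightarrow> legal ls \<and> legal ls'"
  by (auto simp: legal_def)

lemma trip_end_append [simp]: "trip_end y (ls @ ls') = trip_end (trip_end y ls) ls'"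
  by (induction y ls rule: trip_end.induct) auto

lemma trip_time_append [simp]:
  "trip_time y (ls @ ls') = trip_time y ls + trip_time (trip_end y ls) ls'"
  by (induction y ls rule: trip_time.induct) auto

lemma searches_within_append [simp]:
  "searches_within S y (ls @ ls') \<longleftrightarrow>
     searches_within S y ls \<and> searches_within S (trip_end y ls) ls'"
  by (induction S y ls rule: searches_within.induct) auto

lemma passes_append:
  "passes t y (ls @ ls') m x \<tau> \<longleftrightarrow>
     passes t y ls m x \<tau> \<or> passes (t + trip_time y ls) (trip_end y ls) ls' m x \<tau>"
  by (induction t y ls m x \<tau> rule: passes.induct) (auto simp: add.assoc)

lemma searches_within_mono:
  "searches_within S y ls \<Longrightarrow> S \<subseteq> S' \<Longrightarrow> searches_within S' y ls"
  by (induction S y ls rule: searches_within.induct) auto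

lemma passes_within: "passes t y ls m x \<tau> \<Longrightarrow> searches_within S y ls \<Longrightarrow> x \<in> S"
  by (induction t y ls m x \<tau> rule: passes.induct) auto

text \<open>No leg is faster than 1, so the elapsed time is at least the distance travelled, hence
  at least the displacement. Lower bounds on exploration times use this for the parts of a run about
  which nothing else is known.\<close>

lemma passes_time_ge: "passes t y ls m x \<tau> \<Longrightarrow> legal ls \<Longrightarrow> t + \<bar>x - y\<bar> \<le> \<tau>"
proof (induction t y ls m x \<tau> rule: passes.induct)
  case (2 t y z v M ls m x \<tau>)
  have v: "0 < v" "v \<le> 1" and ls: "legal ls" using 2(3) by auto
  have *: "\<bar>w\<bar> \<le> \<bar>w\<bar> / v" for w :: real
    using v mult_left_le_one_le[of "\<bar>w\<bar>" v] by (simp add: field_simps)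
  consider "\<tau> = t + \<bar>x - y\<bar> / v" | "passes (t + \<bar>z - y\<bar> / v) z ls m x \<tau>"
    using 2(2) by auto
  then show ?case
  proof cases
    case 1
    then show ?thesis using *[of "x - y"] by simp
  next
    case later: 2
    show ?thesis using "2.IH"[OF later ls] *[of "z - y"] by linarith
  qed
qed auto

lemma trip_time_nonneg: "legal ls \<Longrightarrow> 0 \<le> trip_time y ls"
  by (induction y ls rule: trip_time.induct) auto

lemma passes_time_le: "passes t y ls m x \<tau> \<Longrightarrow> legal ls \<Longrightarrow> \<tau> \<le> t + trip_time y ls"
proof (induction t y ls m x \<tau> rule: passes.induct)
  case (2 t y z v M ls m x \<tau>)
  have v: "0 < v" and ls: "legal ls" using 2(3) by auto
  consider "x \<in> closed_segment y z" "\<tau> = t + \<bar>x - y\<bar> / v"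
    | "passes (t + \<bar>z - y\<bar> / v) z ls m x \<tau>"
    using 2(2) by auto
  then show ?case
  proof cases
    case 1
    have "\<bar>x - y\<bar> \<le> \<bar>z - y\<bar>"
      using 1(1) by (auto simp: closed_segment_eq_real_ivl split: if_splits)
    then have "\<bar>x - y\<bar> / v \<le> \<bar>z - y\<bar> / v"
      using v by (simp add: divide_right_mono)
    then show ?thesis using 1(2) trip_time_nonneg[OF ls, of z] by simp
  next
    case later: 2
    show ?thesis using "2.IH"[OF later ls] by simp
  qed
qed auto

text \<open>The sign \<open>\<sigma>\<close> is the side of the origin being searched. Factoring it
  out lets both sides be treated at once, in terms of distances from the origin.\<close>

lemma closed_segment_ray:
  fixes \<sigma> x y z :: real
  assumes "\<bar>\<sigma>\<bar> = 1" "x \<le> y"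
  shows "\<sigma> * z \<in> closed_segment (\<sigma> * x) (\<sigma> * y) \<longleftrightarrow> x \<le> z \<and> z \<le> y"
proof -
  have "\<sigma> = 1 \<or> \<sigma> = -1" using assms by linarith
  then show ?thesis using assms by (auto simp: closed_segment_eq_real_ivl)
qed

lemma closed_segment_ray_image:
  fixes \<sigma> x y :: real
  assumes "\<bar>\<sigma>\<bar> = 1" "x \<le> y"
  shows "closed_segment (\<sigma> * x) (\<sigma> * y) = (*) \<sigma> ` {x..y}"
proof -
  have "\<sigma> * \<sigma> = 1" using abs_mult_self_eq[of \<sigma>] assms(1) by simp
  then have s: "\<sigma> * (\<sigma> * w) = w" for w by (simp flip: mult.assoc)
  show ?thesis
  proof (intro set_eqI iffI)
    fix w assume "w \<in> closed_segment (\<sigma> * x) (\<sigma> * y)"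
    then have "\<sigma> * w \<in> {x..y}" using closed_segment_ray[OF assms, of "\<sigma> * w"] s by simp
    then show "w \<in> (*) \<sigma> ` {x..y}" using s[of w] by (intro image_eqI[of w _ "\<sigma> * w"]) simp_all
  next
    fix w assume "w \<in> (*) \<sigma> ` {x..y}"
    then obtain z where "w = \<sigma> * z" "x \<le> z" "z \<le> y" by (meson atLeastAtMost_iff imageE)
    then show "w \<in> closed_segment (\<sigma> * x) (\<sigma> * y)" using closed_segment_ray[OF assms, of z] by simp
  qed
qed

section \<open>Cell searches as back-and-forth sweeps\<close>

definition sweep :: "real \<Rightarrow> real \<Rightarrow> nat \<Rightarrow> leg list" where
  "sweep x z k = map (\<lambda>i. Leg (if even i then z else x) 1 {i}) [0..<k]"

lemma alternating_sum: "(\<Sum>j\<le>i. (-1) ^ j * d) = (if even i then d else (0::real))" for i :: nat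
  by (induction i) auto

text \<open>The alternating partial sums take only two values, so the legs run back and forth
  between the two ends of the cell.\<close>

lemma legs_CellSearch: "legs p (CellSearch x \<delta>) = sweep x (x + \<delta> * sgn x) p"
  using alternating_sum[of "\<delta> * sgn x"] by (auto simp: sweep_def mult.assoc)

lemma sweep_0 [simp]: "sweep x z 0 = []"
  and sweep_Suc: "sweep x z (Suc k) = sweep x z k @ [Leg (if even k then z else x) 1 {k}]"
  by (simp_all add: sweep_def)

lemma trip_end_sweep [simp]: "trip_end x (sweep x z k) = (if even k then x else z)"
  by (induction k) (simp_all add: sweep_Suc)

lemma trip_time_sweep [simp]: "trip_time x (sweep x z k) = real k * \<bar>z - x\<bar>"
  by (induction k) (auto simp: sweep_Suc algebra_simps abs_minus_commute)

text \<open>Mode \<open>m\<close> is active on leg \<open>m\<close> only, which starts after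
  \<open>m\<close> full crossings and runs from \<open>x\<close> to \<open>z\<close> for even
  \<open>m\<close> and from \<open>z\<close> to \<open>x\<close> for odd \<open>m\<close>. The
  passing time is therefore unique.\<close>

lemma passes_sweep:
  "passes t x (sweep x z k) m y \<tau> \<longleftrightarrow>
     m < k \<and> y \<in> closed_segment x z \<and>
     \<tau> = t + real m * \<bar>z - x\<bar> + (if even m then \<bar>y - x\<bar> else \<bar>y - z\<bar>)"
  by (induction k)
    (auto simp: sweep_Suc passes_append closed_segment_commute less_Suc_eq)

lemma legal_sweep [simp]: "legal (sweep x z k)"
  by (auto simp: legal_def sweep_def)

lemma searches_within_sweep [simp]: "searches_within (closed_segment x z) x (sweep x z k)"
  by (induction k) (simp_all add: sweep_Suc closed_segment_commute)

lemma legal_legs [simp]: "legal (legs p st)"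
  by (cases st) (auto simp: legal_def)

lemma legal_concat_legs [simp]: "legal (concat (map (legs p) steps))"
  by (induction steps) auto

lemma prefix_legs_0 [simp]: "prefix_legs p A 0 = []"
  and prefix_legs_Suc: "prefix_legs p A (Suc n) = prefix_legs p A n @ concat (map (legs p) (A n))"
  by (simp_all add: prefix_legs_def)

lemma prefix_legs_add:
  "prefix_legs p A (n + k) =
     prefix_legs p A n @ concat (map (legs p) (concat (map A [n..<n + k])))"
  by (induction k) (simp_all add: prefix_legs_Suc)

text \<open>The half-open interval lets the empty list cover length 0.\<close>

definition covers :: "nat \<Rightarrow> real \<Rightarrow> real \<Rightarrow> real \<Rightarrow> (real \<Rightarrow> real) \<Rightarrow> step list \<Rightarrow> bool" where
  "covers p \<sigma> s \<delta> T steps \<longleftrightarrow>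
     (let ls = concat (map (legs p) steps)
      in searches_within (closed_segment (\<sigma> * s) (\<sigma> * (s + \<delta>))) (\<sigma> * s) ls \<and>
         trip_end (\<sigma> * s) ls = \<sigma> * (s + \<delta>) \<and>
         trip_time (\<sigma> * s) ls = (real p + 1) * \<delta> \<and>
         (\<forall>t. \<forall>y\<in>{s..<s + \<delta>}. \<forall>m<p. \<exists>\<tau>\<le>t + T y. passes t (\<sigma> * s) ls m (\<sigma> * y) \<tau>))"

lemma sgn_ray: "\<bar>\<sigma>\<bar> = 1 \<Longrightarrow> 0 < s \<Longrightarrow> sgn (\<sigma> * s) = \<sigma>" for \<sigma> s :: real
  by (auto simp: sgn_mult abs_if split: if_splits)

lemma legs_CellSearch_ray:
  "\<bar>\<sigma>\<bar> = 1 \<Longrightarrow> 0 < s \<Longrightarrow> legs p (CellSearch (\<sigma> * s) \<delta>) = sweep (\<sigma> * s) (\<sigma> * (s + \<delta>)) p"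
  by (simp only: legs_CellSearch sgn_ray) (simp add: algebra_simps)

lemma abs_ray_diff: "\<bar>\<sigma>\<bar> = 1 \<Longrightarrow> \<bar>\<sigma> * x - \<sigma> * y\<bar> = \<bar>x - y\<bar>" for \<sigma> x y :: real
  by (simp add: abs_mult flip: right_diff_distrib)

text \<open>At speed \<open>1 / (p + 1)\<close> the point at distance \<open>y - s\<close> from the
  starting point is reached after \<open>(p + 1) * (y - s)\<close>, in all modes at once.\<close>

lemma covers_ThoroughSearch:
  assumes "\<bar>\<sigma>\<bar> = 1" "0 < s" "0 \<le> \<delta>"
    and "\<And>y. s \<le> y \<Longrightarrow> y \<le> s + \<delta> \<Longrightarrow> (real p + 1) * (y - s) \<le> T y"
  shows "covers p \<sigma> s \<delta> T [ThoroughSearch (\<sigma> * s) \<delta>]"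
proof -
  have l: "legs p (ThoroughSearch (\<sigma> * s) \<delta>) = [Leg (\<sigma> * (s + \<delta>)) (1 / (real p + 1)) {..<p}]"
    using assms by (simp add: sgn_ray algebra_simps)
  have "\<exists>\<tau>\<le>t + T y. passes t (\<sigma> * s) (legs p (ThoroughSearch (\<sigma> * s) \<delta>)) m (\<sigma> * y) \<tau>"
    if "s \<le> y" "y < s + \<delta>" "m < p" for t y m
    using that assms
    by (intro exI[of _ "t + (real p + 1) * (y - s)"])
      (simp add: l closed_segment_ray abs_ray_diff del: legs.simps)
  then show ?thesis
    using assms by (simp add: covers_def l abs_ray_diff del: legs.simps passes.simps)
qed

text \<open>For even \<open>p\<close> the sweep ends where it began, so sweep and walk to the far
  end take \<open>p * \<Delta> + \<Delta>\<close>, the pace of the thorough search. Each point of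
  the new cell is charged the full sweep, which is what the assumption on \<open>T\<close> pays
  for.\<close>

lemma covers_snoc:
  assumes "\<bar>\<sigma>\<bar> = 1" "0 < s" "0 \<le> x" "0 \<le> \<Delta>" "even p"
    and cov: "covers p \<sigma> s x T steps"
    and T: "\<And>y. s + x \<le> y \<Longrightarrow> y \<le> s + x + \<Delta> \<Longrightarrow> (real p + 1) * x + real p * \<Delta> \<le> T y"
  shows "covers p \<sigma> s (x + \<Delta>) T
           (steps @ [CellSearch (\<sigma> * (s + x)) \<Delta>, GoTo (\<sigma> * (s + x + \<Delta>))])"
proof -
  define ls where "ls = concat (map (legs p) steps)"
  define sw where "sw = sweep (\<sigma> * (s + x)) (\<sigma> * (s + x + \<Delta>)) p"
  have l: "concat (map (legs p) (steps @ [CellSearch (\<sigma> * (s + x)) \<Delta>, GoTo (\<sigma> * (s + x + \<Delta>))])) =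
      ls @ sw @ [Leg (\<sigma> * (s + x + \<Delta>)) 1 {}]"
    using assms by (simp add: ls_def sw_def legs_CellSearch_ray del: legs.simps(3))
  have ls: "searches_within (closed_segment (\<sigma> * s) (\<sigma> * (s + x))) (\<sigma> * s) ls"
    "trip_end (\<sigma> * s) ls = \<sigma> * (s + x)"
    "trip_time (\<sigma> * s) ls = (real p + 1) * x"
    "\<And>t y m. s \<le> y \<Longrightarrow> y < s + x \<Longrightarrow> m < p \<Longrightarrow> \<exists>\<tau>\<le>t + T y. passes t (\<sigma> * s) ls m (\<sigma> * y) \<tau>"
    using cov unfolding covers_def ls_def Let_def by auto
  have sub: "closed_segment (\<sigma> * s) (\<sigma> * (s + x)) \<subseteq> closed_segment (\<sigma> * s) (\<sigma> * (s + x + \<Delta>))"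
    "closed_segment (\<sigma> * (s + x)) (\<sigma> * (s + x + \<Delta>)) \<subseteq> closed_segment (\<sigma> * s) (\<sigma> * (s + x + \<Delta>))"
    using assms by (auto simp: closed_segment_ray_image)
  have "\<exists>\<tau>\<le>t + T y. passes t (\<sigma> * s) (ls @ sw @ [Leg (\<sigma> * (s + x + \<Delta>)) 1 {}]) m (\<sigma> * y) \<tau>"
    if y: "s \<le> y" "y \<le> s + x + \<Delta>" and m: "m < p" for t y m
  proof (cases "y < s + x")
    case True
    then show ?thesis using ls(4)[OF y(1) True m, of t] by (simp only: passes_append) blast
  next
    case False
    let ?t = "t + (real p + 1) * x"
    obtain \<tau> where \<tau>: "passes ?t (\<sigma> * (s + x)) sw m (\<sigma> * y) \<tau>"
      using assms y m False by (auto simp: sw_def passes_sweep closed_segment_ray)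
    have "\<tau> \<le> ?t + real p * \<Delta>"
      using passes_time_le[OF \<tau>] assms by (simp add: sw_def abs_ray_diff)
    also have "\<dots> \<le> t + T y" using T[of y] y False by simp
    finally show ?thesis using \<tau> by (simp only: passes_append ls(2,3)) blast
  qed
  moreover have "searches_within (closed_segment (\<sigma> * s) (\<sigma> * (s + x + \<Delta>))) (\<sigma> * s)
      (ls @ sw @ [Leg (\<sigma> * (s + x + \<Delta>)) 1 {}])"
    using searches_within_mono[OF ls(1) sub(1)]
      searches_within_mono[OF searches_within_sweep sub(2)] ls(2)
    by (simp add: sw_def)
  moreover have "trip_time (\<sigma> * s) (ls @ sw @ [Leg (\<sigma> * (s + x + \<Delta>)) 1 {}]) = (real p + 1) * (x + \<Delta>)"
    using assms ls(2,3) by (simp add: sw_def abs_ray_diff) (simp add: algebra_simps)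
  ultimately show ?thesis
    unfolding covers_def l Let_def add.assoc[symmetric] by simp
qed

subsection \<open>The competitive ratio of two-part search algorithms\<close>

lemma explore_time_le:
  assumes "0 \<le> T" "\<And>m. m < p \<Longrightarrow> \<exists>n. \<exists>\<tau>\<le>T. passes 0 0 (prefix_legs p A n) m x \<tau>"
  shows "explore_time p A x \<le> ereal T"
  unfolding explore_time_def using assms by (intro INF_lower) (auto simp: explored_def)

text \<open>A point is explored only once all modes have passed it, so a single late mode
  suffices.\<close>

lemma explore_time_ge:
  assumes "1 \<le> \<bar>x\<bar>" "m < p" "\<And>n \<tau>. passes 0 0 (prefix_legs p A n) m x \<tau> \<Longrightarrow> T \<le> \<tau>"
  shows "ereal T \<le> explore_time p A x"
  unfolding explore_time_def
proof (rule INF_greatest)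
  fix t assume "t \<in> {t. 0 \<le> t \<and> explored p A x t}"
  then obtain n \<tau> where "\<tau> \<le> t" "passes 0 0 (prefix_legs p A n) m x \<tau>"
    using assms(1,2) by (auto simp: explored_def)
  then show "ereal T \<le> ereal t" using assms(3) by fastforce
qed

lemma explore_time_inner: "\<bar>x\<bar> < 1 \<Longrightarrow> explore_time p A x \<le> 0"
  unfolding explore_time_def zero_ereal_def by (intro INF_lower) (auto simp: explored_def)

text \<open>The parity \<open>P\<close> selects the side. Take the least index of that parity whose
  round reaches \<open>X\<close>: the round two earlier ends exactly where this one starts, and so
  it stopped short of \<open>X\<close>. The first round on either side starts at distance at most
  1.\<close>

lemma round_of_point:
  fixes a X :: real
  assumes "a > 1" "X \<ge> 1"
  shows "\<exists>i. even i = P \<and> a ^ i / a \<le> X \<and> X \<le> a ^ i * a"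
proof -
  define Q where "Q i \<longleftrightarrow> even i = P \<and> X \<le> a ^ i * a" for i :: nat
  obtain n where n: "X < a ^ n" using real_arch_pow assms(1) by blast
  have "a ^ n \<le> a ^ (2 * n) * a" "a ^ n \<le> a ^ (2 * n + 1) * a"
    using power_increasing[of n "2 * n + 1" a] power_increasing[of n "2 * n + 2" a] assms
    by (simp_all add: mult_ac)
  with n have "Q (2 * n) \<or> Q (2 * n + 1)" unfolding Q_def by auto
  then have i: "Q (LEAST i. Q i)" (is "Q ?i") by (auto intro: LeastI)
  have "a ^ ?i / a \<le> X"
  proof (cases "?i < 2")
    case True
    then have "?i = 0 \<or> ?i = 1" by linarith
    then have "a ^ ?i / a \<le> 1" using assms(1) by auto
    then show ?thesis using assms(2) by linarith
  next
    case False
    then obtain k where k: "?i = Suc (Suc k)" by (metis add_2_eq_Suc le_Suc_ex not_less)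
    have "\<not> Q k" using k not_less_Least[of k Q] by simp
    then have "X > a ^ k * a" using i k by (auto simp: Q_def)
    then show ?thesis using k assms(1) by (simp add: mult.commute)
  qed
  then show ?thesis using i Q_def by blast
qed

text \<open>Common frame for both algorithms: \<open>c\<close> stands for the optimal ratio and
  \<open>\<kappa>\<close> for the ratio to be established, equal to \<open>c\<close> for the
  thorough search and to \<open>c + \<epsilon>\<close> for the compliant one. As the first search of
  a round begins no later than time \<open>c * s\<close>, the budget
  \<open>\<kappa> * y - c * s\<close> is what remains until the deadline
  \<open>\<kappa> * y\<close>.\<close>

locale two_part_search =
  fixes p :: nat and a r c \<kappa> :: real and th :: "real \<Rightarrow> real \<Rightarrow> step list"
  assumes even_p: "even p" and p_ge_2: "2 \<le> p" and a_gt_1: "1 < a" and r_pos: "0 < r" and r_le_1: "r \<le> 1"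
    and round_time: "real p * (a\<^sup>2 - 1) + 2 + 2 * r * (a\<^sup>2 - 1) = (c - 1) * (a - 1)"
    and r_eq: "r * (c - 1) = real p"
    and c_le: "c \<le> \<kappa>"
    and th_covers: "\<bar>\<sigma>\<bar> = 1 \<Longrightarrow> 0 < s \<Longrightarrow>
      covers p \<sigma> s (r * (a\<^sup>2 - 1) * s) (\<lambda>y. \<kappa> * y - c * s) (th (\<sigma> * s) (r * (a\<^sup>2 - 1) * s))"
begin

abbreviation "A \<equiv> search_algo th a r"

section \<open>Shape, duration and location of a round\<close>

definition start :: "nat \<Rightarrow> real" where "start i = a ^ i / a"

lemma start_pos [simp]: "0 < start i"
  using a_gt_1 by (simp add: start_def)

lemma start_simps [simp]: "0 \<le> start i" "\<bar>start i\<bar> = start i" "start i \<noteq> 0"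
  using start_pos[of i] by (auto simp del: start_pos)

lemma start_mono: "i \<le> j \<Longrightarrow> start i \<le> start j"
  using a_gt_1 by (simp add: start_def divide_right_mono power_increasing)

lemma start_Suc: "start (Suc i) = a * start i"
  by (simp add: start_def)

lemma a2: "0 < a\<^sup>2 - 1"
  using a_gt_1 by simp

lemma thorough_length_pos: "0 < r * (a\<^sup>2 - 1) * start i"
  using a2 r_pos by simp

lemma c_gt_1: "1 < c"
proof -
  have "0 < r * (c - 1)" using r_eq p_ge_2 by simp
  then show ?thesis using r_pos by (simp add: zero_less_mult_iff)
qed

abbreviation "mid i \<equiv> start i + r * (a\<^sup>2 - 1) * start i"

lemma round_steps:
  "A i = [GoTo ((-1) ^ i * start i)] @ th ((-1) ^ i * start i) (r * (a\<^sup>2 - 1) * start i) @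
     [CellSearch ((-1) ^ i * mid i) ((1 - r) * (a\<^sup>2 - 1) * start i), GoTo 0]"
proof -
  have p: "a powi (int i - 1) = start i" "a powi (int i + 1) = a\<^sup>2 * start i"
    using a_gt_1 by (simp_all add: start_def power_int_diff power_int_add power2_eq_square)
  define \<sigma> where "\<sigma> = (-1 :: real) ^ i"
  have s: "\<bar>\<sigma>\<bar> = 1" by (simp add: \<sigma>_def)
  have 1: "(1 - r) * (\<sigma> * start i) + r * (\<sigma> * (a\<^sup>2 * start i)) = \<sigma> * mid i"
    by (simp add: algebra_simps)
  have 2: "\<bar>\<sigma> * mid i - \<sigma> * start i\<bar> = r * (a\<^sup>2 - 1) * start i"
    using abs_ray_diff[OF s, of "mid i" "start i"] thorough_length_pos[of i] by linarith
  have "a\<^sup>2 * start i - mid i = (1 - r) * (a\<^sup>2 - 1) * start i"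
    by (simp add: algebra_simps)
  then have 3: "\<bar>\<sigma> * (a\<^sup>2 * start i) - \<sigma> * mid i\<bar> = (1 - r) * (a\<^sup>2 - 1) * start i"
    using s a2 r_le_1 by (simp add: abs_ray_diff)
  show ?thesis
    unfolding search_algo_def Let_def p \<sigma>_def[symmetric] 1 2 3 ..
qed

lemma round_legs:
  "concat (map (legs p) (A i)) =
     Leg ((-1) ^ i * start i) 1 {} #
     concat (map (legs p) (th ((-1) ^ i * start i) (r * (a\<^sup>2 - 1) * start i))) @
     sweep ((-1) ^ i * mid i) ((-1) ^ i * (a\<^sup>2 * start i)) p @ [Leg 0 1 {}]"
proof -
  have "0 < mid i" using thorough_length_pos[of i] start_pos[of i] by linarith
  moreover have "mid i + (1 - r) * (a\<^sup>2 - 1) * start i = a\<^sup>2 * start i"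
    by (simp add: algebra_simps)
  ultimately have "legs p (CellSearch ((-1) ^ i * mid i) ((1 - r) * (a\<^sup>2 - 1) * start i)) =
      sweep ((-1) ^ i * mid i) ((-1) ^ i * (a\<^sup>2 * start i)) p"
    using legs_CellSearch_ray[of "(-1) ^ i" "mid i" p] by simp
  then show ?thesis unfolding round_steps by (simp del: legs.simps(3))
qed

lemma thorough:
  fixes i
  defines "ls \<equiv> concat (map (legs p) (th ((-1) ^ i * start i) (r * (a\<^sup>2 - 1) * start i)))"
  shows thorough_within:
      "searches_within (closed_segment ((-1) ^ i * start i) ((-1) ^ i * mid i)) ((-1) ^ i * start i) ls"
    and thorough_end: "trip_end ((-1) ^ i * start i) ls = (-1) ^ i * mid i"
    and thorough_time: "trip_time ((-1) ^ i * start i) ls = (real p + 1) * (r * (a\<^sup>2 - 1) * start i)"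
    and thorough_passes: "start i \<le> y \<Longrightarrow> y < mid i \<Longrightarrow> m < p \<Longrightarrow>
      \<exists>\<tau>\<le>t + (\<kappa> * y - c * start i). passes t ((-1) ^ i * start i) ls m ((-1) ^ i * y) \<tau>"
  using th_covers[of "(-1) ^ i" "start i"] unfolding covers_def ls_def Let_def by simp_all

lemma mid_bounds: "start i \<le> mid i" "mid i \<le> a\<^sup>2 * start i"
proof -
  show "start i \<le> mid i" using thorough_length_pos[of i] by linarith
  have "r * ((a\<^sup>2 - 1) * start i) \<le> 1 * ((a\<^sup>2 - 1) * start i)"
    using a2 r_le_1 start_pos[of i] by (intro mult_right_mono) auto
  then show "mid i \<le> a\<^sup>2 * start i" by (simp add: algebra_simps)
qed

lemma trip_end_round: "trip_end 0 (concat (map (legs p) (A i))) = 0"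
  by (simp add: round_legs thorough_end)

text \<open>The summands are the way out, the first search at \<open>p + 1\<close> per unit length,
  the sweep at \<open>p\<close> per unit length, and the way home from \<open>mid i\<close>, where
  the sweep ends because \<open>p\<close> is even.\<close>

lemma trip_time_round: "trip_time 0 (concat (map (legs p) (A i))) = (c - 1) * (a - 1) * start i"
proof -
  have "trip_time 0 (concat (map (legs p) (A i))) =
      start i + ((real p + 1) * (r * (a\<^sup>2 - 1) * start i) + (real p * (a\<^sup>2 * start i - mid i) + mid i))"
    using even_p mid_bounds[of i] start_pos[of i]
    by (simp add: round_legs thorough_end thorough_time abs_ray_diff abs_mult
        del: start_pos)
  also have "\<dots> = (real p * (a\<^sup>2 - 1) + 2 + 2 * r * (a\<^sup>2 - 1)) * start i"
    by (simp add: algebra_simps)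
  finally show ?thesis by (simp add: round_time)
qed

lemma trip_end_prefix [simp]: "trip_end 0 (prefix_legs p A i) = 0"
  by (induction i) (simp_all add: prefix_legs_Suc trip_end_round)

text \<open>The geometric sum telescopes, since
  \<open>(a - 1) * start i = start (Suc i) - start i\<close> and
  \<open>start 0 = 1 / a\<close>.\<close>

lemma trip_time_prefix: "trip_time 0 (prefix_legs p A i) = (c - 1) * (start i - 1 / a)"
  by (induction i) (simp_all add: start_def prefix_legs_Suc trip_time_round, simp_all add: start_def field_simps)

lemma round_within:
  "searches_within {z. start i \<le> (-1) ^ i * z \<and> (-1) ^ i * z \<le> a\<^sup>2 * start i} 0
     (concat (map (legs p) (A i)))" (is "searches_within ?S _ _")
proof -
  have "(-1 :: real) ^ i * ((-1) ^ i * w) = w" for w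
    by (simp flip: mult.assoc power_mult_distrib)
  then have sub: "closed_segment ((-1) ^ i * start i) ((-1) ^ i * mid i) \<subseteq> ?S"
    "closed_segment ((-1) ^ i * mid i) ((-1) ^ i * (a\<^sup>2 * start i)) \<subseteq> ?S"
    using mid_bounds[of i] by (auto simp: closed_segment_ray_image)
  show ?thesis
    using searches_within_mono[OF thorough_within sub(1)]
      searches_within_mono[OF searches_within_sweep sub(2)]
    by (simp add: round_legs thorough_end)
qed

text \<open>Before \<open>mid i\<close> the budget of \<open>th_covers\<close> applies. From
  \<open>mid i\<close> on, the whole sweep is over by time \<open>c * mid i\<close>, which is at
  most \<open>\<kappa> * y\<close>.\<close>

lemma point_passed:
  assumes y: "start i \<le> y" "y \<le> a\<^sup>2 * start i" and m: "m < p"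
  shows "\<exists>\<tau>\<le>\<kappa> * y. passes 0 0 (prefix_legs p A (Suc i)) m ((-1) ^ i * y) \<tau>"
proof -
  define t where "t = trip_time 0 (prefix_legs p A i) + start i"
  define th_legs where
    "th_legs = concat (map (legs p) (th ((-1) ^ i * start i) (r * (a\<^sup>2 - 1) * start i)))"
  \<comment> \<open>This drops the term \<open>(c - 1) / a\<close>, whose relative size vanishes in
    late rounds; hence the bound is asymptotically sharp.\<close>
  have t: "t \<le> c * start i"
    using c_gt_1 a_gt_1 by (simp add: t_def trip_time_prefix algebra_simps divide_le_cancel)
  have *: "passes 0 0 (prefix_legs p A (Suc i)) m ((-1) ^ i * y) \<tau>"
    if "passes t ((-1) ^ i * start i) th_legs m ((-1) ^ i * y) \<tau> \<or>
        passes (t + (real p + 1) * (r * (a\<^sup>2 - 1) * start i)) ((-1) ^ i * mid i)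
          (sweep ((-1) ^ i * mid i) ((-1) ^ i * (a\<^sup>2 * start i)) p) m ((-1) ^ i * y) \<tau>" for \<tau>
    using that unfolding prefix_legs_Suc round_legs passes_append passes.simps th_legs_def
      thorough_end thorough_time
    by (auto simp: t_def abs_mult add.assoc)
  show ?thesis
  proof (cases "y < mid i")
    case True
    then obtain \<tau> where "\<tau> \<le> t + (\<kappa> * y - c * start i)"
      "passes t ((-1) ^ i * start i) th_legs m ((-1) ^ i * y) \<tau>"
      using thorough_passes[OF y(1) True m, of t] unfolding th_legs_def by blast
    with t * show ?thesis by (intro exI[of _ \<tau>]) auto
  next
    case False
    let ?sw = "sweep ((-1) ^ i * mid i) ((-1) ^ i * (a\<^sup>2 * start i)) p"
    let ?t = "t + (real p + 1) * (r * (a\<^sup>2 - 1) * start i)"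
    obtain \<tau> where \<tau>: "passes ?t ((-1) ^ i * mid i) ?sw m ((-1) ^ i * y) \<tau>"
      using False y mid_bounds[of i] m by (auto simp: passes_sweep closed_segment_ray)
    have "\<tau> \<le> ?t + real p * (a\<^sup>2 * start i - mid i)"
      using passes_time_le[OF \<tau>] mid_bounds[of i] by (simp add: abs_ray_diff)
    also have "\<dots> \<le> c * start i + (real p + 1) * (r * (a\<^sup>2 - 1) * start i) +
        real p * (a\<^sup>2 * start i - mid i)"
      using t by simp
    also have "\<dots> = (c + real p * (a\<^sup>2 - 1) + r * (a\<^sup>2 - 1)) * start i"
      by (simp add: algebra_simps)
    \<comment> \<open>Replacing \<open>p\<close> by \<open>r * (c - 1)\<close> makes
      \<open>c\<close> a common factor; this is the purpose of the value chosen for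
      \<open>r\<close>.\<close>
    also have "\<dots> = c * mid i"
      unfolding r_eq[symmetric] by (simp add: algebra_simps)
    also have "\<dots> \<le> \<kappa> * y"
      using False c_le c_gt_1 start_pos[of i] mid_bounds(1)[of i] by (intro mult_mono) linarith+
    finally show ?thesis using * \<tau> by blast
  qed
qed

lemma CR_le: "CR p A \<le> ereal \<kappa>"
  unfolding CR_def
proof (rule SUP_least)
  fix x :: real assume "x \<in> {x. x \<noteq> 0}"
  then have x: "0 < \<bar>x\<bar>" by simp
  have \<kappa>: "0 < \<kappa>" using c_gt_1 c_le by linarith
  have "explore_time p A x \<le> ereal (\<kappa> * \<bar>x\<bar>)"
  proof (cases "\<bar>x\<bar> < 1")
    case True
    then show ?thesis
      using explore_time_inner[OF True, of p A] \<kappa> by (simp add: order.trans)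
  next
    case False
    then obtain i where i: "even i = (0 < x)" "start i \<le> \<bar>x\<bar>" "\<bar>x\<bar> \<le> a ^ i * a"
      using round_of_point[OF a_gt_1, of "\<bar>x\<bar>" "0 < x"] unfolding start_def by (meson not_less)
    have "\<bar>x\<bar> \<le> a\<^sup>2 * start i" using i(3) a_gt_1 by (simp add: start_def power2_eq_square mult.commute)
    moreover have "(-1) ^ i * \<bar>x\<bar> = x" using i(1) x by (cases "even i") auto
    ultimately show ?thesis
      using point_passed[OF i(2)] \<kappa> by (intro explore_time_le) (auto intro!: exI[of _ "Suc i"])
  qed
  then show "explore_time p A x / ereal \<bar>x\<bar> \<le> ereal \<kappa>"
    using x by (simp add: ereal_divide_le_pos mult.commute)
qed

section \<open>Lower bounds from points just beyond the start of a round\<close>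

lemma earlier_rounds_within:
  "n \<le> i \<Longrightarrow> searches_within {z. (-1) ^ i * z \<le> start i} 0 (prefix_legs p A n)"
proof (induction n)
  case (Suc n)
  \<comment> \<open>Rounds of the other parity search the other side, and those of the same parity
    are at least two rounds earlier, so they end at or before \<open>start i\<close>.\<close>
  have "{z. start n \<le> (-1) ^ n * z \<and> (-1) ^ n * z \<le> a\<^sup>2 * start n} \<subseteq> {z. (-1) ^ i * z \<le> start i}"
  proof (cases "even n = even i")
    case True
    then have "n + 2 \<le> i" using Suc.prems by (cases "i = Suc n") auto
    then have "a\<^sup>2 * start n \<le> start i"
      using start_mono[of "n + 2" i] by (simp add: start_Suc power2_eq_square)
    moreover have "(-1 :: real) ^ n = (-1) ^ i" using True by (cases "even n") auto
    ultimately show ?thesis by auto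
  next
    case False
    then have "(-1 :: real) ^ n = - ((-1) ^ i)" by (cases "even n") auto
    then show ?thesis using start_pos[of n] start_pos[of i] by (auto simp del: start_pos)
  qed
  from searches_within_mono[OF round_within this] Suc show ?case
    by (simp add: prefix_legs_Suc)
qed simp

text \<open>Beyond \<open>start i\<close> nothing on this side is searched before round
  \<open>i\<close>, so the clock may be started there. Of the later rounds, collected in
  \<open>ls\<close>, only the speed limit is remembered.\<close>

lemma passes_from_round:
  assumes "start i < y" "passes 0 0 (prefix_legs p A n) m ((-1) ^ i * y) \<tau>"
  shows "\<exists>ls. legal ls \<and>
    passes (trip_time 0 (prefix_legs p A i)) 0 (concat (map (legs p) (A i)) @ ls) m ((-1) ^ i * y) \<tau>"
proof -
  have "(-1) ^ i * ((-1) ^ i * y) = y" by (simp flip: mult.assoc power_mult_distrib)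
  then have notin: "\<not> passes 0 0 (prefix_legs p A n') m ((-1) ^ i * y) \<tau>" if "n' \<le> i" for n'
    using passes_within[OF _ earlier_rounds_within[OF that]] assms(1) by fastforce
  then obtain k where "n = i + Suc k"
    using assms(2) by (metis add_Suc_right less_imp_Suc_add not_less)
  then have eq: "prefix_legs p A n = prefix_legs p A i @ concat (map (legs p) (A i)) @
      concat (map (legs p) (concat (map A [Suc i..<i + Suc k])))"
    by (simp only: prefix_legs_add[of p A i "Suc k"] upt_conv_Cons[of i "i + Suc k"]
        less_add_Suc1 list.map concat.simps map_append concat_append)
  then show ?thesis
    using assms(2) notin[of i] passes_append[of 0 0 "prefix_legs p A i"]
    unfolding eq trip_end_prefix by (metis add_0 legal_concat_legs order_refl)
qed

lemma explore_time_ge_simple: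
  assumes "start i < y" "1 \<le> y"
  shows "ereal (trip_time 0 (prefix_legs p A i) + y) \<le> explore_time p A ((-1) ^ i * y)"
proof (rule explore_time_ge[of _ 0])
  fix n \<tau> assume "passes 0 0 (prefix_legs p A n) 0 ((-1) ^ i * y) \<tau>"
  from passes_from_round[OF assms(1) this] obtain ls where "legal ls"
    and "passes (trip_time 0 (prefix_legs p A i)) 0 (concat (map (legs p) (A i)) @ ls) 0 ((-1) ^ i * y) \<tau>"
    by blast
  from passes_time_ge[OF this(2)] this(1) show "trip_time 0 (prefix_legs p A i) + y \<le> \<tau>"
    using assms(2) by (simp add: abs_mult)
qed (use assms p_ge_2 in \<open>auto simp: abs_mult\<close>)

text \<open>The last mode \<open>p - 1\<close> is odd, so its leg returns from the far end of the
  first cell and meets the points near \<open>start i\<close> at its very end, after almost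
  \<open>p * \<Delta>\<close>. A passage after that cell is later still, because \<open>y\<close>
  exceeds \<open>start i\<close>.\<close>

lemma explore_time_ge_cell:
  assumes th: "th ((-1) ^ i * start i) (r * (a\<^sup>2 - 1) * start i) = CellSearch ((-1) ^ i * start i) \<Delta> # steps"
    and y: "start i < y" "y \<le> start i + \<Delta>" "1 \<le> y"
  shows "ereal (trip_time 0 (prefix_legs p A i) + 2 * start i + real p * \<Delta> - y)
           \<le> explore_time p A ((-1) ^ i * y)"
proof (rule explore_time_ge[of _ "p - 1"])
  define t where "t = trip_time 0 (prefix_legs p A i)"
  let ?x = "(-1) ^ i * start i"
  let ?sw = "sweep ?x ((-1) ^ i * (start i + \<Delta>)) p"
  fix n \<tau> assume "passes 0 0 (prefix_legs p A n) (p - 1) ((-1) ^ i * y) \<tau>"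
  from passes_from_round[OF y(1) this] obtain ls where ls: "legal ls"
    and passes: "passes t 0 (concat (map (legs p) (A i)) @ ls) (p - 1) ((-1) ^ i * y) \<tau>"
    by (auto simp: t_def)
  define ls' where "ls' = concat (map (legs p) steps) @ sweep ((-1) ^ i * mid i) ((-1) ^ i * (a\<^sup>2 * start i)) p @
      [Leg 0 1 {}] @ ls"
  have ls': "legal ls'" using ls by (simp add: ls'_def)
  have "concat (map (legs p) (A i)) @ ls = Leg ?x 1 {} # ?sw @ ls'"
    unfolding round_legs th ls'_def by (simp add: legs_CellSearch_ray del: legs.simps)
  with passes have "passes (t + start i) ?x (?sw @ ls') (p - 1) ((-1) ^ i * y) \<tau>"
    by (simp add: abs_mult)
  then consider "passes (t + start i) ?x ?sw (p - 1) ((-1) ^ i * y) \<tau>"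
    | "passes (t + start i + real p * \<Delta>) ?x ls' (p - 1) ((-1) ^ i * y) \<tau>"
    using even_p y by (auto simp: passes_append abs_ray_diff)
  then show "trip_time 0 (prefix_legs p A i) + 2 * start i + real p * \<Delta> - y \<le> \<tau>"
  proof cases
    case 1
    then have "\<tau> = t + start i + real (p - 1) * \<Delta> + (start i + \<Delta> - y)"
      using even_p p_ge_2 y by (simp add: passes_sweep abs_ray_diff)
    then show ?thesis
      using p_ge_2 by (simp add: t_def of_nat_diff algebra_simps)
  next
    case 2
    then show ?thesis using passes_time_ge[OF 2 ls'] y by (simp add: t_def)
  qed
qed (use y p_ge_2 in \<open>auto simp: abs_mult\<close>)

text \<open>The test points \<open>start i * (1 + d / i)\<close> stay within relative distance
  \<open>d\<close> beyond the start, yet approach it. Dividing the bound by \<open>y\<close> gives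
  \<open>g i\<close>, which tends to \<open>(c - 1) + 1 + e\<close>.\<close>

lemma CR_ge:
  assumes "0 < d"
    and bound: "\<And>i y. 1 \<le> i \<Longrightarrow> start i < y \<Longrightarrow> y \<le> start i + d * start i \<Longrightarrow>
      ereal (trip_time 0 (prefix_legs p A i) + (2 + e) * start i - y) \<le> explore_time p A ((-1) ^ i * y)"
  shows "ereal (c + e) \<le> CR p A"
proof -
  define h where "h i = d / real i" for i
  define g where "g i = ((c - 1) * (1 - inverse (a ^ i)) + 1 + e - h i) / (1 + h i)" for i
  have h: "h \<longlonglongrightarrow> 0" unfolding h_def by (rule lim_const_over_n)
  have "(\<lambda>i. inverse (a ^ i)) \<longlonglongrightarrow> 0" using a_gt_1 by (rule LIMSEQ_inverse_realpow_zero)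
  then have "g \<longlonglongrightarrow> ((c - 1) * (1 - 0) + 1 + e - 0) / (1 + 0)"
    unfolding g_def by (intro tendsto_intros h) auto
  then have lim: "(\<lambda>i. ereal (g i)) \<longlonglongrightarrow> ereal (c + e)" by simp
  \<comment> \<open>Index 0 is left out: \<open>start 0 = 1 / a\<close> is below 1, and
    \<open>d / 0 = 0\<close> would put the test point at the start itself.\<close>
  have "ereal (g i) \<le> CR p A" if i: "1 \<le> i" for i
  proof -
    have hi: "0 < h i" "h i \<le> d" using assms(1) i by (auto simp: h_def field_simps)
    define y where "y = start i + h i * start i"
    have y: "start i < y" "y \<le> start i + d * start i" "0 < y"
      using hi start_pos[of i] by (auto simp: y_def add_pos_pos simp del: start_pos)
    have y_eq: "y = start i * (1 + h i)" by (simp add: y_def algebra_simps)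
    have "1 / a = start i * inverse (a ^ i)" using a_gt_1 by (simp add: start_def field_simps)
    then have "trip_time 0 (prefix_legs p A i) + (2 + e) * start i - y =
        start i * ((c - 1) * (1 - inverse (a ^ i)) + 1 + e - h i)"
      by (simp only: trip_time_prefix y_def) (simp add: algebra_simps)
    then have "g i = (trip_time 0 (prefix_legs p A i) + (2 + e) * start i - y) / y"
      using start_pos[of i] by (simp add: g_def y_eq del: start_pos)
    also have "ereal \<dots> = ereal (trip_time 0 (prefix_legs p A i) + (2 + e) * start i - y) / ereal y"
      using y(3) by simp
    also have "\<dots> \<le> explore_time p A ((-1) ^ i * y) / ereal \<bar>(-1) ^ i * y\<bar>"
      using ereal_divide_right_mono[OF bound[OF i y(1,2)], of "ereal y"] y(3)
      by (simp only: abs_mult power_abs) simp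
    also have "\<dots> \<le> CR p A"
      unfolding CR_def using y(3) by (intro SUP_upper) simp
    finally show ?thesis .
  qed
  then show ?thesis by (intro Lim_bounded[OF lim, of 1]) auto
qed

lemma start_ge_1: "1 \<le> i \<Longrightarrow> 1 \<le> start i"
  using start_mono[of 1 i] a_gt_1 by (simp add: start_def)

text \<open>For \<open>y\<close> beyond \<open>start i\<close> the travel bound \<open>t + y\<close>
  exceeds \<open>t + 2 * start i - y\<close>, the form needed with \<open>e = 0\<close>. The choice
  \<open>d = 1\<close> is arbitrary.\<close>

lemma CR_ge_simple: "ereal c \<le> CR p A"
proof -
  have "ereal (c + 0) \<le> CR p A"
  proof (rule CR_ge[of 1])
    fix i y assume i: "1 \<le> (i :: nat)" and y: "start i < y"
    then have "ereal (trip_time 0 (prefix_legs p A i) + (2 + 0) * start i - y) \<le>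
        ereal (trip_time 0 (prefix_legs p A i) + y)"
      by simp
    also have "\<dots> \<le> explore_time p A ((-1) ^ i * y)"
      using explore_time_ge_simple[OF y] y start_ge_1[OF i] by simp
    finally show "ereal (trip_time 0 (prefix_legs p A i) + (2 + 0) * start i - y)
        \<le> explore_time p A ((-1) ^ i * y)" .
  qed simp
  then show ?thesis by simp
qed

text \<open>A first cell of length \<open>e * start i / p\<close> costs \<open>e * start i\<close>
  to sweep, which is the extra delay at its near end.\<close>

lemma CR_ge_cell:
  assumes "0 < e"
    and th: "\<And>i. \<exists>steps. th ((-1) ^ i * start i) (r * (a\<^sup>2 - 1) * start i) =
      CellSearch ((-1) ^ i * start i) (e * start i / real p) # steps"
  shows "ereal (c + e) \<le> CR p A"
proof (rule CR_ge[of "e / real p"])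
  fix i y assume i: "1 \<le> i" and y: "start i < y" "y \<le> start i + e / real p * start i"
  obtain steps where steps: "th ((-1) ^ i * start i) (r * (a\<^sup>2 - 1) * start i) =
      CellSearch ((-1) ^ i * start i) (e * start i / real p) # steps"
    using th by blast
  from explore_time_ge_cell[OF this y(1)] y start_ge_1[OF i] p_ge_2
  show "ereal (trip_time 0 (prefix_legs p A i) + (2 + e) * start i - y) \<le> explore_time p A ((-1) ^ i * y)"
    by (simp add: algebra_simps)
qed (use assms p_ge_2 in simp)

end

subsection \<open>The compliant search\<close>

text \<open>The first cell already swallows the whole region, so the loop runs once and the result
  depends on neither \<open>c\<close> nor \<open>\<epsilon>\<close>.\<close>

lemma compliant_thorough_search_single:
  assumes "0 < p" "0 < \<delta>" "\<delta> \<le> \<epsilon> * \<bar>x\<bar> / real p"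
  shows "compliant_thorough_search p c \<epsilon> x \<delta> = [CellSearch x \<delta>, GoTo (x + \<delta> * sgn x)]"
  using assms unfolding compliant_thorough_search_def
  by (subst while_unfold, simp add: min_def, subst while_unfold) simp

text \<open>The hypothesis \<open>growth\<close> makes each cell at least twice as long as its
  predecessor, apart from a truncated last one. The exponent is the number of calls minus 2 because
  the last cell may be truncated, whereas the one before it has full length and ends strictly inside
  the region.\<close>

lemma compliant_thorough_search_spec:
  assumes p: "even p" "0 < p" and \<sigma>: "\<bar>\<sigma>\<bar> = 1" and pos: "0 < s" "0 < \<delta>" "0 < \<epsilon>"
    and growth: "2 * real p \<le> c + \<epsilon> - 1"
  defines "st \<equiv> compliant_thorough_search p c \<epsilon> (\<sigma> * s) \<delta>"
    and "w0 \<equiv> \<epsilon> * s / real p"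
  shows "covers p \<sigma> s \<delta> (\<lambda>y. (c + \<epsilon>) * y - c * s) st"
    and "\<exists>steps. st = CellSearch (\<sigma> * s) (min w0 \<delta>) # steps"
    and "2 \<le> cell_search_calls st \<Longrightarrow> w0 * 2 ^ (cell_search_calls st - 2) < \<delta>"
proof -
  define \<rho> where "\<rho> = (c + \<epsilon> - 1) / real p"
  have \<rho>: "2 \<le> \<rho>" "real p * \<rho> = c + \<epsilon> - 1" using growth p by (simp_all add: \<rho>_def field_simps)
  have w0: "0 < w0" "real p * w0 = \<epsilon> * s" using p pos by (simp_all add: w0_def)
  define T where "T = (\<lambda>y. (c + \<epsilon>) * y - c * s)"
  have abs_x: "\<bar>\<sigma> * s\<bar> = s" using \<sigma> pos by (simp add: abs_mult)
  have sg: "\<sigma> * s + x * sgn (\<sigma> * s) = \<sigma> * (s + x)" for x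
    using sgn_ray[OF \<sigma>, of s] pos by (simp add: algebra_simps)
  \<comment> \<open>The equation between \<open>x\<close> and \<open>w\<close> says that a cell of full length \<open>w\<close> started at offset
    \<open>x\<close> makes the ratio \<open>c + \<epsilon>\<close> tight at its first point; the growth factor of the cells
    preserves it.\<close>
  define Inv where "Inv x w st \<longleftrightarrow> (let k = cell_search_calls st in
      0 \<le> x \<and> x \<le> \<delta> \<and> w = w0 * \<rho> ^ k \<and> covers p \<sigma> s x T st \<and>
      (x < \<delta> \<longrightarrow> c * s + (real p + 1) * x + real p * w = (c + \<epsilon>) * (s + x)) \<and>
      (st = [] \<and> x = 0 \<or> (\<exists>steps. st = CellSearch (\<sigma> * s) (min w0 \<delta>) # steps)) \<and>
      (2 \<le> k \<longrightarrow> w0 * \<rho> ^ (k - 2) < \<delta>) \<and> (1 \<le> k \<longrightarrow> x = \<delta> \<or> w0 * \<rho> ^ (k - 1) \<le> x))"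
    for x w st
  define f where "f = (\<lambda>(x, w, st). let \<Delta> = min w (\<delta> - x)
     in (x + \<Delta>, w * ((c + \<epsilon> - 1) / real p),
         st @ [CellSearch (\<sigma> * s + x * sgn (\<sigma> * s)) \<Delta>, GoTo (\<sigma> * s + (x + \<Delta>) * sgn (\<sigma> * s))]))"
  define final where "final = while (\<lambda>(x, w, st). x < \<delta>) f (0, w0, [])"
  have step: "Inv (x + \<Delta>) (w * \<rho>)
        (st @ [CellSearch (\<sigma> * (s + x)) \<Delta>, GoTo (\<sigma> * (s + x + \<Delta>))])"
    and w_ge: "w0 \<le> w"
    if I: "Inv x w st" and x: "x < \<delta>" and \<Delta>: "\<Delta> = min w (\<delta> - x)" for x w \<Delta> st
  proof -
    define k where "k = cell_search_calls st"
    have I': "0 \<le> x" "w = w0 * \<rho> ^ k" "covers p \<sigma> s x T st"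
      "c * s + (real p + 1) * x + real p * w = (c + \<epsilon>) * (s + x)"
      "st = [] \<and> x = 0 \<or> (\<exists>steps. st = CellSearch (\<sigma> * s) (min w0 \<delta>) # steps)"
      "1 \<le> k \<Longrightarrow> w0 * \<rho> ^ (k - 1) \<le> x"
      using I x by (auto simp: Inv_def k_def Let_def)
    have "1 \<le> \<rho> ^ k" using \<rho> by (intro one_le_power) auto
    then show w_ge: "w0 \<le> w" using w0 by (simp add: I'(2))
    have \<Delta>': "0 \<le> \<Delta>" "\<Delta> \<le> w" "x + \<Delta> \<le> \<delta>" "x + \<Delta> = \<delta> \<or> \<Delta> = w" using w_ge w0 x by (auto simp: \<Delta>)
    have k': "cell_search_calls (st @ [CellSearch (\<sigma> * (s + x)) \<Delta>, GoTo (\<sigma> * (s + x + \<Delta>))]) = Suc k"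
      by (simp add: cell_search_calls_def k_def)
    \<comment> \<open>\<open>T\<close> is increasing, and by the tight equation it already pays at
      \<open>s + x\<close> for the sweep of a full cell; truncation only shortens the sweep.\<close>
    have cov: "covers p \<sigma> s (x + \<Delta>) T (st @ [CellSearch (\<sigma> * (s + x)) \<Delta>, GoTo (\<sigma> * (s + x + \<Delta>))])"
    proof (rule covers_snoc)
      fix y assume "s + x \<le> y"
      have "(real p + 1) * x + real p * \<Delta> \<le> (real p + 1) * x + real p * w"
        using \<Delta>' by (simp add: mult_left_mono)
      also have "\<dots> = (c + \<epsilon>) * (s + x) - c * s" using I'(4) by simp
      also have "\<dots> \<le> T y"
        using \<open>s + x \<le> y\<close> growth p by (auto simp: T_def intro!: mult_left_mono)
      finally show "(real p + 1) * x + real p * \<Delta> \<le> T y" .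
    qed (use I' \<Delta>' \<sigma> pos p in auto)
    have first: "\<exists>steps. st @ [CellSearch (\<sigma> * (s + x)) \<Delta>, GoTo (\<sigma> * (s + x + \<Delta>))] =
        CellSearch (\<sigma> * s) (min w0 \<delta>) # steps"
      using I'(5)
    proof
      assume "st = [] \<and> x = 0"
      then show ?thesis using I'(2) by (simp add: k_def \<Delta> cell_search_calls_def)
    qed auto
    have small: "w0 * \<rho> ^ (Suc k - 2) < \<delta>" if "2 \<le> Suc k"
      using I'(6) that x by (simp add: numeral_2_eq_2)
    \<comment> \<open>A full cell adds \<open>(p + 1) * w + p * w * \<rho> - p * w\<close> to the
      left side. With \<open>p * \<rho> = c + \<epsilon> - 1\<close> this is
      \<open>(c + \<epsilon>) * w\<close>, the gain on the right.\<close>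
    have ratio: "c * s + (real p + 1) * (x + \<Delta>) + real p * (w * \<rho>) = (c + \<epsilon>) * (s + (x + \<Delta>))"
      if "\<Delta> = w"
    proof -
      have "real p * (w * \<rho>) = w * (c + \<epsilon> - 1)" using \<rho>(2) by (simp add: mult_ac)
      then show ?thesis using I'(4) that by (simp add: algebra_simps)
    qed
    show "Inv (x + \<Delta>) (w * \<rho>) (st @ [CellSearch (\<sigma> * (s + x)) \<Delta>, GoTo (\<sigma> * (s + x + \<Delta>))])"
      unfolding Inv_def Let_def k'
      using I' \<Delta>' cov first small ratio by auto
  qed
  \<comment> \<open>The loop terminates because cells never get shorter than \<open>w0\<close>: each
    pass finishes the region or removes at least one unit of length \<open>w0\<close> from what is
    left.\<close>
  have "case final of (x, w, st) \<Rightarrow> Inv x w st \<and> \<delta> \<le> x"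
    unfolding final_def
  proof (rule while_rule[where P = "\<lambda>(x, w, st). Inv x w st"
        and r = "Wellfounded.measure (\<lambda>(x, w, st). nat \<lceil>(\<delta> - x) / w0\<rceil>)"])
    have "covers p \<sigma> s 0 T []" by (simp add: covers_def)
    then show "case (0, w0, []) of (x, w, st) \<Rightarrow> Inv x w st"
      using pos w0 by (simp add: Inv_def cell_search_calls_def algebra_simps)
  next
    fix z assume z: "case z of (x, w, st) \<Rightarrow> Inv x w st" "case z of (x, w, st) \<Rightarrow> x < \<delta>"
    obtain x w st where z_eq: "z = (x, w, st)" by (cases z)
    have I: "Inv x w st" "x < \<delta>" using z by (simp_all add: z_eq)
    show "case f z of (x, w, st) \<Rightarrow> Inv x w st"
      using step[OF I refl] by (simp add: z_eq f_def Let_def sg \<rho>_def add.assoc)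
    define \<Delta> where "\<Delta> = min w (\<delta> - x)"
    have "\<Delta> = \<delta> - x \<or> w0 \<le> \<Delta>" using w_ge[OF I refl] by (auto simp: \<Delta>_def)
    then have "nat \<lceil>(\<delta> - (x + \<Delta>)) / w0\<rceil> < nat \<lceil>(\<delta> - x) / w0\<rceil>"
    proof
      assume "w0 \<le> \<Delta>"
      then have "(\<delta> - (x + \<Delta>)) / w0 \<le> (\<delta> - x) / w0 - 1" using w0 by (simp add: field_simps)
      then have "\<lceil>(\<delta> - (x + \<Delta>)) / w0\<rceil> \<le> \<lceil>(\<delta> - x) / w0\<rceil> - 1"
        using ceiling_mono by fastforce
      moreover have "0 < \<lceil>(\<delta> - x) / w0\<rceil>" using I w0 by simp
      ultimately show ?thesis by linarith
    qed (use I w0 in simp)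
    then show "(f z, z) \<in> Wellfounded.measure (\<lambda>(x, w, st). nat \<lceil>(\<delta> - x) / w0\<rceil>)"
      by (simp add: z_eq f_def Let_def \<Delta>_def)
  qed auto
  moreover have "st = snd (snd final)"
    unfolding st_def final_def f_def compliant_thorough_search_def abs_x w0_def
    by (simp add: case_prod_beta)
  ultimately obtain x w where "Inv x w st" "\<delta> \<le> x"
    by (cases final) auto
  then have I: "covers p \<sigma> s \<delta> T st" "\<exists>steps. st = CellSearch (\<sigma> * s) (min w0 \<delta>) # steps"
    "2 \<le> cell_search_calls st \<Longrightarrow> w0 * \<rho> ^ (cell_search_calls st - 2) < \<delta>"
    using pos by (auto simp: Inv_def Let_def)
  show "covers p \<sigma> s \<delta> (\<lambda>y. (c + \<epsilon>) * y - c * s) st"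
    using I(1) by (simp add: T_def)
  show "\<exists>steps. st = CellSearch (\<sigma> * s) (min w0 \<delta>) # steps" by (rule I(2))
  assume "2 \<le> cell_search_calls st"
  moreover have "w0 * 2 ^ (cell_search_calls st - 2) \<le> w0 * \<rho> ^ (cell_search_calls st - 2)"
    using w0 \<rho> by (intro mult_left_mono power_mono) auto
  ultimately show "w0 * 2 ^ (cell_search_calls st - 2) < \<delta>" using I(3) by linarith
qed

subsection \<open>The optimal parameters\<close>

text \<open>The square isolates \<open>u ^ 2 * (u - 2 * p) ^ 2\<close>, which equals
  \<open>8 * p * u ^ 2\<close> at the left end of the admissible interval.\<close>

lemma D_shift:
  "D p (u + 1) = (u\<^sup>2 - 2 * real p * u)\<^sup>2 - 16 * real p * u\<^sup>2 + 16 * real p * (real p - 1) * u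
     + 16 * (real p)\<^sup>2"
  by (simp add: D_def power2_eq_square power4_eq_xxxx algebra_simps)

lemma sqrt_8p: "2 \<le> p \<Longrightarrow> 4 \<le> sqrt (8 * real p)"
  by (rule real_le_rsqrt) simp

text \<open>Intermediate value theorem between the left end of the interval and
  \<open>6 * p + 1\<close>. The explicit upper end is what later bounds \<open>a\<close> by
  3.\<close>

lemma c_star_exists:
  assumes p: "2 \<le> p"
  shows "\<exists>c. is_c_star p c \<and> c \<le> 6 * real p + 1"
proof -
  define w where "w = sqrt (8 * real p)"
  have w: "w\<^sup>2 = 8 * real p" "4 \<le> w" using sqrt_8p[OF p] by (simp_all add: w_def)
  have "w \<le> 4 * real p"
    unfolding w_def using p by (intro real_le_lsqrt) (simp_all add: power2_eq_square)
  define u where "u = 2 * real p + w"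
  have "(u\<^sup>2 - 2 * real p * u)\<^sup>2 = w\<^sup>2 * u\<^sup>2"
    by (simp add: u_def power2_eq_square algebra_simps)
  then have "D p (u + 1) = - 8 * real p * (u\<^sup>2 - 2 * (real p - 1) * u - 2 * real p)"
    unfolding D_shift w(1) by (simp add: power2_eq_square algebra_simps)
  also have "u\<^sup>2 - 2 * (real p - 1) * u - 2 * real p = u * (w + 2) - 2 * real p"
    by (simp add: u_def power2_eq_square algebra_simps)
  also have "- 8 * real p * \<dots> \<le> 0"
  proof -
    have "2 * real p * 1 \<le> u * (w + 2)" unfolding u_def using w(2) by (intro mult_mono) auto
    then show ?thesis by (simp add: mult_nonneg_nonneg)
  qed
  finally have lo: "D p (2 * real p + 1 + w) \<le> 0" by (simp add: u_def add_ac)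
  have "D p (6 * real p + 1) =
      36 * (real p)\<^sup>2 * (16 * (real p * (real p - 1))) + 16 * real p * (real p - 1) * (6 * real p) + 16 * (real p)\<^sup>2"
    unfolding D_shift by (simp add: power2_eq_square algebra_simps)
  also have "\<dots> \<ge> 0" using p by (intro add_nonneg_nonneg mult_nonneg_nonneg) auto
  finally have hi: "0 \<le> D p (6 * real p + 1)" .
  have "continuous_on {2 * real p + 1 + w..6 * real p + 1} (D p)"
    unfolding D_def[abs_def] by (intro continuous_intros)
  from IVT'[OF lo hi _ this] \<open>w \<le> 4 * real p\<close> show ?thesis
    by (auto simp: is_c_star_def w_def)
qed

text \<open>Up to the factor \<open>u\<^sup>2\<close>, the function \<open>u \<mapsto> D p (u + 1)\<close> is strictly increasing here.\<close>

lemma c_star_unique: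
  assumes p: "2 \<le> p" and c: "is_c_star p c" "is_c_star p c'"
  shows "c = c'"
proof -
  have False if "is_c_star p c" "is_c_star p c'" "c < c'" for c c'
  proof -
    define P where "P = real p"
    define u v where "u = c - 1" and "v = c' - 1"
    have uv: "u < v" and P: "2 \<le> P" using that p by (simp_all add: u_def v_def P_def)
    have bounds: "2 * P + 4 \<le> u" "2 * P + 4 \<le> v"
      using that(1,2) sqrt_8p[OF p] by (simp_all add: is_c_star_def u_def v_def P_def)
    have zero: "D p (u + 1) = 0" "D p (v + 1) = 0"
      using that(1,2) by (simp_all add: is_c_star_def u_def v_def)
    \<comment> \<open>This is the difference of \<open>D p (v + 1) / v ^ 2\<close> and
      \<open>D p (u + 1) / u ^ 2\<close>, cleared of denominators.\<close>
    have "0 = D p (v + 1) * u\<^sup>2 - D p (u + 1) * v\<^sup>2" by (simp add: zero)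
    also have "\<dots> = (v - u) * ((u * v)\<^sup>2 * (u + v - 4 * P) - 16 * P * (P - 1) * (u * v) - 16 * P\<^sup>2 * (u + v))"
      unfolding D_shift P_def[symmetric] by (simp add: power2_eq_square algebra_simps)
    also have "\<dots> > 0"
    proof -
      \<comment> \<open>Each negative term is at most \<open>4 * (u * v) ^ 2\<close>, the first one
        strictly, while \<open>u + v - 4 * P\<close> is at least 8.\<close>
      have PP: "4 * P\<^sup>2 \<le> u * v"
        using mult_mono[of "2 * P" u "2 * P" v] bounds P by (simp add: power2_eq_square)
      have uv_pos: "0 < u * v" using bounds P by simp
      have "2 * u \<le> v * u" "2 * v \<le> u * v" using bounds P by (intro mult_right_mono; simp)+
      then have sum: "u + v \<le> u * v" by (simp add: mult.commute)
      have "16 * P * (P - 1) * (u * v) < 16 * P\<^sup>2 * (u * v)"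
        using uv_pos P by (intro mult_strict_right_mono) (auto simp: power2_eq_square)
      also have "\<dots> \<le> 4 * (u * v) * (u * v)" using PP uv_pos by (intro mult_right_mono) auto
      finally have 1: "16 * P * (P - 1) * (u * v) < 4 * (u * v)\<^sup>2" by (simp add: power2_eq_square)
      have "16 * P\<^sup>2 * (u + v) \<le> 4 * (u * v) * (u * v)"
        using PP sum uv_pos bounds P by (intro mult_mono[of "16 * P\<^sup>2"]) linarith+
      then have 2: "16 * P\<^sup>2 * (u + v) \<le> 4 * (u * v)\<^sup>2" by (simp add: power2_eq_square)
      have "(u * v)\<^sup>2 * 8 \<le> (u * v)\<^sup>2 * (u + v - 4 * P)"
        using bounds by (intro mult_left_mono) auto
      with 1 2 have "0 < (u * v)\<^sup>2 * (u + v - 4 * P) - 16 * P * (P - 1) * (u * v) - 16 * P\<^sup>2 * (u + v)"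
        by linarith
      then show ?thesis using uv by simp
    qed
    finally show False by simp
  qed
  then show ?thesis using c by (metis linorder_neqE)
qed

lemma ex1_c_star: "2 \<le> p \<Longrightarrow> \<exists>!c. is_c_star p c"
  using c_star_exists c_star_unique by metis

lemma c_star:
  assumes "2 \<le> p"
  shows is_c_star_c_star: "is_c_star p (c_star p)" and c_star_le: "c_star p \<le> 6 * real p + 1"
proof -
  show *: "is_c_star p (c_star p)"
    unfolding c_star_def by (rule theI'[OF ex1_c_star[OF assms]])
  show "c_star p \<le> 6 * real p + 1"
    using c_star_exists[OF assms] c_star_unique[OF assms *] by blast
qed

context
  fixes p :: nat and u a r :: real
  assumes p: "2 \<le> p"
  defines "u \<equiv> c_star p - 1" and "a \<equiv> opt_a p" and "r \<equiv> opt_r p"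
begin

lemma u_bounds: "2 * real p + 4 \<le> u" "u \<le> 6 * real p"
  using is_c_star_c_star[OF p] c_star_le[OF p] sqrt_8p[OF p] by (simp_all add: is_c_star_def u_def)

lemma opt_a_eq: "a = u\<^sup>2 / (2 * real p * (u + 2))"
  by (simp add: a_def u_def opt_a_def add.commute)

text \<open>The lower bound compares \<open>2 * p \<le> u - 4\<close> with
  \<open>u ^ 2 = (u - 4) * (u + 2) + 2 * u + 8\<close>; the upper one comes from
  \<open>u \<le> 6 * p\<close>.\<close>

lemma opt_a_bounds: "1 < a" "a \<le> 3"
proof -
  have "2 * real p * (u + 2) \<le> (u - 4) * (u + 2)"
    using u_bounds by (intro mult_right_mono) auto
  then have "2 * real p * (u + 2) < (u - 4) * (u + 2) + 8 + 2 * u"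
    using u_bounds p by linarith
  also have "\<dots> = u\<^sup>2" by (simp add: power2_eq_square algebra_simps)
  finally show "1 < a" using u_bounds p by (simp add: opt_a_eq)
  have "u * u \<le> 6 * real p * (u + 2)" using u_bounds p by (intro mult_mono) auto
  then have "u\<^sup>2 \<le> 3 * (2 * real p * (u + 2))" by (simp add: power2_eq_square)
  then show "a \<le> 3" unfolding opt_a_eq using u_bounds p by (subst pos_divide_le_eq) auto
qed

text \<open>This is the round-time equation for \<open>r = p / u\<close>, multiplied by
  \<open>u\<close>. The equation \<open>D p c = 0\<close> reads
  \<open>u ^ 4 = 4 * p * (u + 2) ^ 2 * (u - p)\<close>, and inserting the definition of
  \<open>a\<close> turns it into the claim.\<close>

lemma opt_a_quadratic: "real p * (u + 2) * (a\<^sup>2 - 1) + 2 * u = u\<^sup>2 * (a - 1)"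
proof -
  have pos: "0 < real p" "0 < u + 2" using u_bounds p by auto
  have a: "2 * real p * (u + 2) * a = u\<^sup>2" using pos by (simp add: opt_a_eq)
  have "D p (c_star p) = 0" using is_c_star_c_star[OF p] by (simp add: is_c_star_def)
  then have "u ^ 4 = 4 * real p * (u + 2)\<^sup>2 * (u - real p)"
    by (simp add: D_def u_def algebra_simps)
  moreover have "u ^ 4 = 2 * real p * (u + 2) * (u\<^sup>2 * a)"
  proof -
    have "u ^ 4 = u\<^sup>2 * u\<^sup>2" by (simp flip: power_add)
    also have "\<dots> = (2 * real p * (u + 2) * a) * u\<^sup>2" by (simp only: a)
    finally show ?thesis by (simp only: mult_ac)
  qed
  ultimately have "2 * real p * (u + 2) * (u\<^sup>2 * a) = 2 * real p * (u + 2) * (2 * (u + 2) * (u - real p))"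
    by (simp add: power2_eq_square algebra_simps)
  then have "u\<^sup>2 * a = 2 * (u + 2) * (u - real p)" using pos by simp
  moreover have "2 * (real p * (u + 2) * a\<^sup>2) = u\<^sup>2 * a" using a by (simp add: power2_eq_square)
  ultimately show ?thesis by (simp add: power2_eq_square algebra_simps)
qed

text \<open>With \<open>q = a ^ 2 - 1\<close>, multiplying the round-time equation by
  \<open>p / u\<close> gives \<open>2 * q * x ^ 2 + (p * q + 2) * x = p * (a - 1)\<close> at
  \<open>x = p / u\<close>. The definition of \<open>opt_r\<close> is the quadratic formula for the
  positive root.\<close>

lemma opt_r_eq: "r = real p / u"
  and opt_round_time: "real p * (a\<^sup>2 - 1) + 2 + 2 * r * (a\<^sup>2 - 1) = u * (a - 1)"
proof -
  define q where "q = a\<^sup>2 - 1"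
  define r' where "r' = real p / u"
  have u: "0 < u" using u_bounds p by simp
  have q: "0 < q" using opt_a_bounds by (simp add: q_def)
  have r': "r' * u = real p" "0 \<le> r'" using u by (simp_all add: r'_def)
  have "u * (real p * q + 2 + 2 * r' * q) = real p * u * q + 2 * u + 2 * (r' * u) * q"
    by (simp add: algebra_simps)
  also have "\<dots> = u * (u * (a - 1))"
    using opt_a_quadratic unfolding q_def[symmetric] r'(1)
    by (simp add: power2_eq_square algebra_simps)
  finally have "u * (real p * q + 2 + 2 * r' * q) = u * (u * (a - 1))" .
  then have rt: "real p * q + 2 + 2 * r' * q = u * (a - 1)" using u by simp
  have "real p * (a - 1) = r' * (real p * q + 2 + 2 * r' * q)"
    unfolding rt using r'(1) by simp
  then have "(real p * q + 2)\<^sup>2 + 8 * real p * q * (a - 1) = (4 * q * r' + real p * q + 2)\<^sup>2"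
  proof -
    have "8 * real p * q * (a - 1) = 8 * q * (real p * (a - 1))" by (simp only: mult_ac)
    also note \<open>real p * (a - 1) = _\<close>
    finally show ?thesis by (simp add: power2_eq_square algebra_simps)
  qed
  then have "r = (\<bar>4 * q * r' + real p * q + 2\<bar> - 2) / (4 * q) - real p / 4"
    unfolding r_def opt_r_def Let_def a_def[symmetric] q_def[symmetric] by simp
  also have "\<dots> = r'" using q r' by (simp add: field_simps)
  finally show "r = real p / u" by (simp add: r'_def)
  with rt show "real p * (a\<^sup>2 - 1) + 2 + 2 * r * (a\<^sup>2 - 1) = u * (a - 1)"
    by (simp add: r'_def q_def)
qed

lemma opt_r_bounds: "0 < r" "r \<le> 1 / 2"
  using u_bounds p by (auto simp: opt_r_eq field_simps)

lemma opt_cover_factor_le: "r * (a\<^sup>2 - 1) \<le> 4"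
proof -
  have "a * a \<le> 3 * 3" using opt_a_bounds by (intro mult_mono) auto
  then have "r * (a\<^sup>2 - 1) \<le> 1 / 2 * 8"
    using opt_r_bounds opt_a_bounds by (intro mult_mono) (auto simp flip: power2_eq_square)
  then show ?thesis by simp
qed

lemma two_part_search_opt:
  assumes "even p" "c_star p \<le> \<kappa>"
    and "\<And>\<sigma> s. \<bar>\<sigma>\<bar> = 1 \<Longrightarrow> 0 < s \<Longrightarrow>
      covers p \<sigma> s (r * (a\<^sup>2 - 1) * s) (\<lambda>y. \<kappa> * y - c_star p * s) (th (\<sigma> * s) (r * (a\<^sup>2 - 1) * s))"
  shows "two_part_search p a r (c_star p) \<kappa> th"
  using assms p opt_a_bounds opt_r_bounds opt_round_time u_bounds
  by unfold_locales (auto simp: opt_r_eq simp flip: u_def)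

lemma cover_length_pos: "0 < s \<Longrightarrow> 0 < r * (a\<^sup>2 - 1) * s"
  using opt_r_bounds opt_a_bounds by simp

section \<open>Competitive ratios and call count of the two algorithms\<close>

context
  assumes even: "even p"
begin

text \<open>Here \<open>\<kappa> = c\<close>: beyond \<open>s\<close> the thorough search proceeds
  at cost \<open>p + 1 \<le> c\<close> per unit length, so the ratio never rises above its value at
  the start.\<close>

lemma CR_algo_A: "CR p (algo_A p) = ereal (c_star p)"
proof -
  interpret two_part_search p a r "c_star p" "c_star p" "\<lambda>x \<delta>. [ThoroughSearch x \<delta>]"
  proof (rule two_part_search_opt)
    fix \<sigma> s :: real assume s: "\<bar>\<sigma>\<bar> = 1" "0 < s"
    show "covers p \<sigma> s (r * (a\<^sup>2 - 1) * s) (\<lambda>y. c_star p * y - c_star p * s)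
        [ThoroughSearch (\<sigma> * s) (r * (a\<^sup>2 - 1) * s)]"
    proof (rule covers_ThoroughSearch)
      fix y assume "s \<le> y"
      then have "(real p + 1) * (y - s) \<le> c_star p * (y - s)"
        using u_bounds by (intro mult_right_mono) (auto simp: u_def)
      then show "(real p + 1) * (y - s) \<le> c_star p * y - c_star p * s"
        by (simp add: algebra_simps)
    qed (use s cover_length_pos[of s] in auto)
  qed (use even in auto)
  show ?thesis
    using CR_le CR_ge_simple by (simp add: algo_A_def a_def r_def)
qed

lemma algo_B_eq: "algo_B p \<epsilon> = search_algo (compliant_thorough_search p (c_star p) \<epsilon>) a r"
  by (simp add: algo_B_def CR_algo_A a_def r_def)

lemma spec_B:
  assumes "\<bar>\<sigma>\<bar> = 1" "0 < s" "0 < \<epsilon>"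
  defines "\<delta> \<equiv> r * (a\<^sup>2 - 1) * s"
  defines "st \<equiv> compliant_thorough_search p (c_star p) \<epsilon> (\<sigma> * s) \<delta>"
  shows "covers p \<sigma> s \<delta> (\<lambda>y. (c_star p + \<epsilon>) * y - c_star p * s) st"
    and "\<exists>steps. st = CellSearch (\<sigma> * s) (min (\<epsilon> * s / real p) \<delta>) # steps"
    and "2 \<le> cell_search_calls st \<Longrightarrow> \<epsilon> * s / real p * 2 ^ (cell_search_calls st - 2) < \<delta>"
  using compliant_thorough_search_spec[of p \<sigma> s \<delta> \<epsilon> "c_star p"] assms even p
    cover_length_pos[of s] u_bounds by (auto simp: u_def)

lemma two_part_search_B:
  "0 < \<epsilon> \<Longrightarrow> two_part_search p a r (c_star p) (c_star p + \<epsilon>) (compliant_thorough_search p (c_star p) \<epsilon>)"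
  using spec_B even by (intro two_part_search_opt) auto

lemma CR_algo_B_le: "0 < \<epsilon> \<Longrightarrow> CR p (algo_B p \<epsilon>) \<le> ereal (c_star p + \<epsilon>)"
  unfolding algo_B_eq by (rule two_part_search.CR_le[OF two_part_search_B])

text \<open>The bound on \<open>\<epsilon>\<close> says that a first cell of length
  \<open>\<epsilon> * s / p\<close> fits into the region of length
  \<open>r * (a ^ 2 - 1) * s\<close>. It is then not truncated and causes the full delay.\<close>

lemma CR_algo_B:
  assumes "0 < \<epsilon>" "\<epsilon> \<le> real p * r * (a\<^sup>2 - 1)"
  shows "CR p (algo_B p \<epsilon>) = ereal (c_star p + \<epsilon>)"
proof (rule antisym[OF CR_algo_B_le[OF assms(1)]])
  interpret two_part_search p a r "c_star p" "c_star p + \<epsilon>" "compliant_thorough_search p (c_star p) \<epsilon>"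
    using assms(1) by (rule two_part_search_B)
  have "min (\<epsilon> * start i / real p) (r * (a\<^sup>2 - 1) * start i) = \<epsilon> * start i / real p" for i
    using mult_right_mono[OF assms(2), of "start i"] p by (simp add: min_def field_simps)
  then show "ereal (c_star p + \<epsilon>) \<le> CR p (algo_B p \<epsilon>)"
    unfolding algo_B_eq
    using spec_B(2)[of "(-1) ^ i" "start i" \<epsilon> for i] assms(1) by (intro CR_ge_cell) auto
qed

text \<open>From this threshold on, one cell covers the whole region, and a larger
  \<open>\<epsilon>\<close> changes nothing.\<close>

lemma algo_B_saturates:
  assumes "real p * r * (a\<^sup>2 - 1) \<le> \<epsilon>"
  shows "algo_B p \<epsilon> = algo_B p (real p * r * (a\<^sup>2 - 1))"
proof
  fix i
  define \<epsilon>' where "\<epsilon>' = real p * r * (a\<^sup>2 - 1)"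
  have \<epsilon>': "0 < \<epsilon>'" "\<epsilon>' \<le> \<epsilon>" using cover_length_pos[of 1] p assms by (simp_all add: \<epsilon>'_def mult.assoc)
  interpret B: two_part_search p a r "c_star p" "c_star p + \<epsilon>" "compliant_thorough_search p (c_star p) \<epsilon>"
    using \<epsilon>' by (intro two_part_search_B) simp
  interpret B': two_part_search p a r "c_star p" "c_star p + \<epsilon>'" "compliant_thorough_search p (c_star p) \<epsilon>'"
    using \<epsilon>' by (intro two_part_search_B) simp
  have 1: "r * (a\<^sup>2 - 1) * B.start i \<le> \<epsilon>' * \<bar>(-1) ^ i * B.start i\<bar> / real p"
    using p by (simp add: \<epsilon>'_def abs_mult)
  also have "\<dots> \<le> \<epsilon> * \<bar>(-1) ^ i * B.start i\<bar> / real p"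
    using \<epsilon>' by (intro divide_right_mono mult_right_mono) auto
  finally show "algo_B p \<epsilon> i = algo_B p (real p * r * (a\<^sup>2 - 1)) i"
    unfolding algo_B_eq \<epsilon>'_def[symmetric] B.round_steps B'.round_steps
    using p cover_length_pos[OF B.start_pos] 1
    by (simp only: compliant_thorough_search_single)
qed

text \<open>Above the threshold the algorithm is the one for the threshold itself, whose ratio is
  strictly below \<open>c_star p + \<epsilon>\<close>.\<close>

lemma CR_algo_B_eq_iff:
  assumes "0 < \<epsilon>"
  shows "CR p (algo_B p \<epsilon>) = ereal (c_star p + \<epsilon>) \<longleftrightarrow> \<epsilon> \<le> real p * r * (a\<^sup>2 - 1)"
proof
  assume eq: "CR p (algo_B p \<epsilon>) = ereal (c_star p + \<epsilon>)"
  show "\<epsilon> \<le> real p * r * (a\<^sup>2 - 1)"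
  proof (rule ccontr)
    assume not_le: "\<not> \<epsilon> \<le> real p * r * (a\<^sup>2 - 1)"
    moreover have "0 < real p * r * (a\<^sup>2 - 1)"
      using cover_length_pos[of 1] p by (simp add: mult.assoc)
    ultimately have "CR p (algo_B p \<epsilon>) = ereal (c_star p + real p * r * (a\<^sup>2 - 1))"
      using algo_B_saturates[of \<epsilon>] by (simp add: CR_algo_B)
    then show False using eq not_le by simp
  qed
qed (rule CR_algo_B[OF assms])

text \<open>Doubling cells give \<open>2 ^ (k - 2) < 4 * p / \<epsilon>\<close> for the
  \<open>k\<close> calls of the compliant search. The second part of the round adds one call, and
  \<open>large\<close> makes the logarithm at least 1, so \<open>7 + 2 * ln (p / \<epsilon>)\<close>
  is absorbed by the factor 9.\<close>

lemma cell_search_calls_algo_B: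
  assumes \<epsilon>: "0 < \<epsilon>" and large: "exp 1 \<le> real p / \<epsilon>"
  shows "real (cell_search_calls (algo_B p \<epsilon> i)) \<le> 9 * ln (real p / \<epsilon>)"
proof -
  interpret two_part_search p a r "c_star p" "c_star p + \<epsilon>" "compliant_thorough_search p (c_star p) \<epsilon>"
    using \<epsilon> by (rule two_part_search_B)
  define k where "k = cell_search_calls
    (compliant_thorough_search p (c_star p) \<epsilon> ((-1) ^ i * start i) (r * (a\<^sup>2 - 1) * start i))"
  have calls: "cell_search_calls (algo_B p \<epsilon> i) = k + 1"
    unfolding algo_B_eq round_steps by (simp add: cell_search_calls_def k_def)
  have z: "0 < real p / \<epsilon>" using \<epsilon> p by simp
  have ln_ge: "1 \<le> ln (real p / \<epsilon>)" using large z by (simp add: ln_ge_iff)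
  have "real k \<le> 6 + 2 * ln (real p / \<epsilon>)"
  proof (cases "2 \<le> k")
    case True
    then have "\<epsilon> * start i / real p * 2 ^ (k - 2) < r * (a\<^sup>2 - 1) * start i"
      using spec_B(3)[of "(-1) ^ i" "start i" \<epsilon>] \<epsilon> by (simp add: k_def)
    also have "\<dots> \<le> 4 * start i" using opt_cover_factor_le by (intro mult_right_mono) auto
    finally have "2 ^ (k - 2) < 4 * (real p / \<epsilon>)"
      using \<epsilon> p start_pos[of i] by (simp add: field_simps del: start_pos)
    then have "ln (2 ^ (k - 2)) < ln (2\<^sup>2 * (real p / \<epsilon>))"
      using z by (subst ln_less_cancel_iff) auto
    also have "\<dots> = 2 * ln 2 + ln (real p / \<epsilon>)"
      using z ln_realpow[of 2 2] by (subst ln_mult_pos) simp_all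
    finally have "(real k - 2) * ln 2 < 2 * ln 2 + ln (real p / \<epsilon>)"
      using True by (simp add: ln_realpow of_nat_diff)
    then have "(real k - 4) * ln 2 \<le> ln (real p / \<epsilon>)" by (simp add: algebra_simps)
    moreover have "(real k - 4) * (1 / 2) \<le> (real k - 4) * ln 2" if "4 \<le> real k"
      using that ln2_ge_two_thirds by (intro mult_left_mono) auto
    ultimately show ?thesis using ln_ge by argo
  qed (use ln_ge in simp)
  then show ?thesis unfolding calls using ln_ge by simp
qed

end

end

text \<open>The equality of ratios is an equivalence because it fails once one cell covers the whole
  region. The filter lets \<open>p / \<epsilon>\<close> tend to infinity over the admissible pairs
  and leaves \<open>i\<close> free, so the constant is uniform in \<open>p\<close>,
  \<open>\<epsilon>\<close> and the round.\<close>

theorem theorem7: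
  shows
    "(\<forall>p::nat. even p \<and> p \<ge> 2 \<longrightarrow>
        (\<exists>!c. is_c_star p c) \<and>
        opt_a p > 1 \<and> 0 \<le> opt_r p \<and> opt_r p \<le> 1 \<and>
        CR p (algo_A p) = ereal (c_star p) \<and>
        (\<forall>\<epsilon>>0.
           CR p (algo_B p \<epsilon>) \<le> CR p (algo_A p) + ereal \<epsilon> \<and>
           (CR p (algo_B p \<epsilon>) = CR p (algo_A p) + ereal \<epsilon> \<longleftrightarrow>
              \<epsilon> \<le> real p * opt_r p * ((opt_a p)\<^sup>2 - 1)))) \<and>
     (\<lambda>(p, \<epsilon>, i). real (cell_search_calls (algo_B p \<epsilon> i)))
        \<in> O[inf (filtercomap (\<lambda>(p::nat, \<epsilon>::real, i::nat). real p / \<epsilon>) at_top)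
                 (principal {(p, \<epsilon>, i). even p \<and> p \<ge> 2 \<and> \<epsilon> > 0})](
             \<lambda>(p, \<epsilon>, i). ln (real p / \<epsilon>))"
proof (intro conjI allI impI)
  fix p :: nat assume "even p \<and> 2 \<le> p"
  then have p: "even p" "2 \<le> p" by auto
  show "\<exists>!c. is_c_star p c" using p(2) by (rule ex1_c_star)
  show "1 < opt_a p" using p(2) by (rule opt_a_bounds)
  show "0 \<le> opt_r p" "opt_r p \<le> 1" using opt_r_bounds[OF p(2)] by auto
  show CR_A: "CR p (algo_A p) = ereal (c_star p)" using p(2,1) by (rule CR_algo_A)
  fix \<epsilon> :: real assume \<epsilon>: "0 < \<epsilon>"
  show "CR p (algo_B p \<epsilon>) \<le> CR p (algo_A p) + ereal \<epsilon>"
    using CR_algo_B_le[OF p(2,1) \<epsilon>] by (simp add: CR_A)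
  show "CR p (algo_B p \<epsilon>) = CR p (algo_A p) + ereal \<epsilon> \<longleftrightarrow>
      \<epsilon> \<le> real p * opt_r p * ((opt_a p)\<^sup>2 - 1)"
    using CR_algo_B_eq_iff[OF p(2,1) \<epsilon>] by (simp add: CR_A)
next
  show "(\<lambda>(p, \<epsilon>, i). real (cell_search_calls (algo_B p \<epsilon> i)))
      \<in> O[inf (filtercomap (\<lambda>(p::nat, \<epsilon>::real, i::nat). real p / \<epsilon>) at_top)
               (principal {(p, \<epsilon>, i). even p \<and> p \<ge> 2 \<and> \<epsilon> > 0})](\<lambda>(p, \<epsilon>, i). ln (real p / \<epsilon>))"
  proof (rule bigoI[of _ 9])
    have "real (cell_search_calls (algo_B p \<epsilon> i)) \<le> 9 * \<bar>ln (real p / \<epsilon>)\<bar>"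
      if "exp 1 \<le> real p / \<epsilon>" "even p" "2 \<le> p" "0 < \<epsilon>" for p \<epsilon> i
      using cell_search_calls_algo_B[OF that(3,2,4,1), of i] by linarith
    then show "eventually (\<lambda>z. norm (case z of (p, \<epsilon>, i) \<Rightarrow> real (cell_search_calls (algo_B p \<epsilon> i)))
          \<le> 9 * norm (case z of (p, \<epsilon>, i) \<Rightarrow> ln (real p / \<epsilon>)))
        (inf (filtercomap (\<lambda>(p::nat, \<epsilon>::real, i::nat). real p / \<epsilon>) at_top)
          (principal {(p, \<epsilon>, i). even p \<and> p \<ge> 2 \<and> \<epsilon> > 0}))"
      unfolding eventually_inf_principal eventually_filtercomap
      by (intro exI[of _ "\<lambda>z. exp 1 \<le> z"] conjI eventually_ge_at_top) auto
  qed
qed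

end
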